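(* For each $n$, let $z \in \{\pm 1\}^n$ be a fixed vector, let $\sigma = \sigma_n \ge 0$, and let $$ C = z z^T + \sigma W, $$ where $W$ is a random real symmetric $n \times n$ matrix whose entries are independent (up to symmetry) and identically distributed standard normal random variables. Suppose that, for some $\epsilon > 0$ independent of $n$, $$ \sigma \le \sqrt{\frac{n}{(2 + \epsilon) \log n}} . $$ Then, with probability $\to 1$ as $n \to \infty$, the following holds: for all integers $r \ge 2$, every second-order critical point $Y$ of $$ \max_{Y \in \mathbf{R}^{n \times r}} \ \langle C, Y Y^T \rangle \quad \text{subject to} \quad \operatorname{diag}(Y Y^T) = \mathbf{1} $$ satisfies $Y Y^T = z z^T$.
   Context: Notation: $\langle A, B\rangle = \operatorname{tr}(A^T B)$; $\mathbf{1}$ is the all-ones vector in $\mathbf{R}^n$; for a square matrix $A$, $\operatorname{diag}(A)$ is the vector of its diagonal entries and $\operatorname{ddiag}(A)$ is the diagonal matrix with the same diagonal as $A$. The noise parameter $\sigma$ may depend on $n$. Second-order critical point: a feasible point $Y \in \mathbf{R}^{n\times r}$ (i.e. $\operatorname{diag}(YY^T) = \mathbf{1}$) at which the Riemannian gradient of the objective on the product of unit spheres is zero and the Riemannian Hessian is negative semidefinite. Equivalently, with $S(Y) := \operatorname{ddiag}(C Y Y^T) - C$, one has $S(Y) Y = 0$ and $\langle S(Y), \dot Y \dot Y^T\rangle \ge 0$ for all $\dot Y \in \mathbf{R}^{n \times r}$ with $\operatorname{diag}(Y \dot Y^T) = 0$. *)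

theory Defs
  imports "HOL-Probability.Probability" "Jordan_Normal_Form.Matrix"
begin

definition mat_inner :: "real mat \<Rightarrow> real mat \<Rightarrow> real" where
  "mat_inner A B = sum_list (diag_mat (transpose_mat A * B))"

definition ddiag :: "real mat \<Rightarrow> real mat" where
  "ddiag A = mat_diag (dim_row A) (\<lambda>i. A $$ (i, i))"

definition outer :: "real Matrix.vec \<Rightarrow> real mat" where
  "outer z = Matrix.mat (dim_vec z) (dim_vec z) (\<lambda>(i, j). vec_index z i * vec_index z j)"

definition sphere_product :: "nat \<Rightarrow> nat \<Rightarrow> real mat set" where
  "sphere_product n r =
     {Y \<in> carrier_mat n r. diag_mat (Y * transpose_mat Y) = replicate n 1}"

definition tangent_space :: "real mat \<Rightarrow> real mat set" where
  "tangent_space Y =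
     {V \<in> carrier_mat (dim_row Y) (dim_col Y).
        diag_mat (Y * transpose_mat V) = replicate (dim_row Y) 0}"

text \<open>
  The orthogonal projection onto \<^term>\<open>tangent_space Y\<close>, for \<open>Y\<close> in the product of spheres:
  row \<open>i\<close> of \<open>Z\<close> loses its component along row \<open>i\<close> of \<open>Y\<close>.
\<close>

definition tangent_proj :: "real mat \<Rightarrow> real mat \<Rightarrow> real mat" where
  "tangent_proj Y Z = Z - ddiag (Z * transpose_mat Y) * Y"

definition euclidean_grad :: "(real mat \<Rightarrow> real) \<Rightarrow> real mat \<Rightarrow> real mat" where
  "euclidean_grad f Y = Matrix.mat (dim_row Y) (dim_col Y) (\<lambda>(i, j).
     deriv (\<lambda>t. f (Y + t \<cdot>\<^sub>m Matrix.mat (dim_row Y) (dim_col Y)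
                              (\<lambda>(k, l). if k = i \<and> l = j then 1 else 0))) 0)"

definition riemannian_grad :: "(real mat \<Rightarrow> real) \<Rightarrow> real mat \<Rightarrow> real mat" where
  "riemannian_grad f Y = tangent_proj Y (euclidean_grad f Y)"

text \<open>
  On a Riemannian submanifold of a Euclidean space the Levi-Civita connection is the tangential
  part of the ambient directional derivative. The formula for \<^const>\<open>riemannian_grad\<close> makes sense at
  every matrix, so it serves as the smooth extension of the gradient field that is differentiated
  here; for \<open>V\<close> in \<^term>\<open>tangent_space Y\<close> the result does not depend on the extension.
\<close>

definition riemannian_hess :: "(real mat \<Rightarrow> real) \<Rightarrow> real mat \<Rightarrow> real mat \<Rightarrow> real mat" where
  "riemannian_hess f Y V = tangent_proj Y (Matrix.mat (dim_row Y) (dim_col Y) (\<lambda>(i, j).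
     deriv (\<lambda>t. riemannian_grad f (Y + t \<cdot>\<^sub>m V) $$ (i, j)) 0))"

text \<open>Second-order criticality for the problem of maximizing \<open>f\<close> over the product of spheres.\<close>

definition second_order_critical :: "nat \<Rightarrow> nat \<Rightarrow> (real mat \<Rightarrow> real) \<Rightarrow> real mat \<Rightarrow> bool" where
  "second_order_critical n r f Y \<longleftrightarrow>
     Y \<in> sphere_product n r \<and>
     riemannian_grad f Y = 0\<^sub>m n r \<and>
     (\<forall>V \<in> tangent_space Y. mat_inner V (riemannian_hess f Y V) \<le> 0)"

text \<open>
  Independence is required of the entries on and above the diagonal only; the diagonal entries are
  standard normal like all the others.
\<close>

definition gaussian_symmetric_matrix :: "'a measure \<Rightarrow> nat \<Rightarrow> ('a \<Rightarrow> real mat) \<Rightarrow> bool" where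
  "gaussian_symmetric_matrix M n W \<longleftrightarrow>
     (\<forall>\<omega> \<in> space M. W \<omega> \<in> carrier_mat n n \<and> transpose_mat (W \<omega>) = W \<omega>) \<and>
     prob_space.indep_vars M (\<lambda>_. borel) (\<lambda>(i, j) \<omega>. W \<omega> $$ (i, j)) {(i, j). i \<le> j \<and> j < n} \<and>
     (\<forall>i < n. \<forall>j < n. distributed M lborel (\<lambda>\<omega>. W \<omega> $$ (i, j)) std_normal_density)"

end

theory Submission
  imports Defs "HOL-Real_Asymp.Real_Asymp"
begin

text \<open>
  Conjugating by the signs \<open>z\<close> reduces to \<open>z = 1\<close>, with \<open>C = 1 1\<^sup>T + \<sigma> W\<close>. Let \<open>d = C 1\<close>,
  \<open>L = diag d - C\<close> and let expectations and variances refer to the weights proportional to \<open>d\<close>.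

  With high probability \<open>d \<ge> c n\<close> entrywise (Gaussian tails of the row sums; this is where the
  threshold \<open>2 + \<epsilon>\<close> enters) and the operator norm of \<open>W\<close> is \<open>O(\<surd>n)\<close> (union bound over a lattice net).
  Then \<open>L\<close>, preconditioned by \<open>d\<close>, has condition number \<open>1 + o(1)\<close>: the form \<open>x\<^sup>T L x\<close> is a multiple
  of the variance of \<open>x\<close> up to a factor close to 1.

  For a second-order critical point with rows \<open>y\<^sub>i\<close>, let the mean of the rows be \<open>s e\<close> with a unit
  vector \<open>e\<close>, let \<open>a\<^sub>i = \<langle>y\<^sub>i, e\<rangle>\<close>, and let \<open>\<mu>\<close> be the mean of \<open>a\<^sup>2\<close>. Testing the Hessian on the
  projections of fixed directions, first \<open>e\<close> and then those orthogonal to \<open>e\<close>, forces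
  \<open>\<mu>\<close> and \<open>s\<^sup>2\<close> to be close to 1. The first-order condition gives \<open>L Y = diag \<tau> Y\<close>, hence \<open>\<Sum> \<tau>\<^sub>i a\<^sub>i = 0\<close>,
  and comparing \<open>\<langle>L, Y Y\<^sup>T\<rangle> = \<Sum> \<tau>\<^sub>i (1 - a\<^sub>i)\<close> with the mean of \<open>(1 - a)\<^sup>2\<close> then forces \<open>s = 1\<close>, so
  that all rows agree.
\<close>

section \<open>Critical points of well-conditioned Laplacians\<close>

definition row_proj :: "nat \<Rightarrow> (nat \<Rightarrow> nat \<Rightarrow> real) \<Rightarrow> (nat \<Rightarrow> nat \<Rightarrow> real) \<Rightarrow> nat \<Rightarrow> nat \<Rightarrow> real" where
  "row_proj r Y Z i l = Z i l - (\<Sum>k<r. Z i k * Y i k) * Y i l"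

text \<open>The diagonal of \<open>C Y Y^T\<close>, that is, the Lagrange multiplier of the
  unit-norm constraint on row \<open>i\<close>.\<close>

definition multiplier :: "nat \<Rightarrow> nat \<Rightarrow> (nat \<Rightarrow> nat \<Rightarrow> real) \<Rightarrow> (nat \<Rightarrow> nat \<Rightarrow> real) \<Rightarrow> nat \<Rightarrow> real" where
  "multiplier n r C Y i = (\<Sum>j<n. C i j * (\<Sum>l<r. Y i l * Y j l))"

text \<open>
  Second-order criticality in coordinates. Tangent vectors are parametrized as the row-wise
  projections of arbitrary \<open>Z\<close>, so that each condition is closed in \<open>(C, Y)\<close>.
\<close>

definition soc :: "nat \<Rightarrow> nat \<Rightarrow> (nat \<Rightarrow> nat \<Rightarrow> real) \<Rightarrow> (nat \<Rightarrow> nat \<Rightarrow> real) \<Rightarrow> bool" where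
  "soc n r C Y \<longleftrightarrow>
     (\<forall>i<n. (\<Sum>l<r. (Y i l)\<^sup>2) = 1) \<and>
     (\<forall>i<n. \<forall>l<r. (\<Sum>j<n. C i j * Y j l) = multiplier n r C Y i * Y i l) \<and>
     (\<forall>Z. (\<Sum>i<n. \<Sum>j<n. C i j * (\<Sum>l<r. row_proj r Y Z i l * row_proj r Y Z j l))
          \<le> (\<Sum>i<n. multiplier n r C Y i * (\<Sum>l<r. (row_proj r Y Z i l)\<^sup>2)))"

text \<open>The bilinear form of the signed Laplacian \<open>diag (C 1) - C\<close>.\<close>

definition lap :: "nat \<Rightarrow> (nat \<Rightarrow> nat \<Rightarrow> real) \<Rightarrow> (nat \<Rightarrow> real) \<Rightarrow> (nat \<Rightarrow> real) \<Rightarrow> real" where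
  "lap n C x y = (\<Sum>i<n. x i * (\<Sum>j<n. C i j * (y i - y j)))"

section \<open>Bilinearity and symmetry of the Laplacian form\<close>

lemma lap_diff_left: "lap n C (\<lambda>i. x i - x' i) y = lap n C x y - lap n C x' y"
  by (simp add: lap_def left_diff_distrib sum_subtractf)

lemma lap_scale_left: "lap n C (\<lambda>i. c * x i) y = c * lap n C x y"
  by (simp add: lap_def sum_distrib_left mult.assoc)

lemma lap_diff_right: "lap n C x (\<lambda>i. y i - y' i) = lap n C x y - lap n C x y'"
proof -
  have "C i j * (y i - y' i - (y j - y' j)) = C i j * (y i - y j) - C i j * (y' i - y' j)" for i j
    by (simp add: algebra_simps)
  then show ?thesis by (simp add: lap_def sum_subtractf right_diff_distrib)
qed

lemma lap_scale_right: "lap n C x (\<lambda>i. c * y i) = c * lap n C x y"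
proof -
  have "C i j * (c * y i - c * y j) = c * (C i j * (y i - y j))" for i j
    by (simp add: algebra_simps)
  then have "x i * (\<Sum>j<n. C i j * (c * y i - c * y j)) = c * (x i * (\<Sum>j<n. C i j * (y i - y j)))" for i
    by (simp only: sum_distrib_left[symmetric] mult.left_commute)
  then show ?thesis by (simp add: lap_def sum_distrib_left)
qed

lemma lap_const_right: "lap n C x (\<lambda>i. c) = 0"
  by (simp add: lap_def)

lemma lap_sum_right: "lap n C x (\<lambda>i. \<Sum>k\<in>A. y k i) = (\<Sum>k\<in>A. lap n C x (y k))"
proof -
  have "lap n C x (\<lambda>i. \<Sum>k\<in>A. y k i) = (\<Sum>i<n. \<Sum>j<n. \<Sum>k\<in>A. x i * (C i j * (y k i - y k j)))"
    by (simp add: lap_def sum_distrib_left sum_subtractf[symmetric])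
  also have "\<dots> = (\<Sum>k\<in>A. \<Sum>i<n. \<Sum>j<n. x i * (C i j * (y k i - y k j)))"
    by (simp add: sum.swap[of _ A])
  finally show ?thesis by (simp add: lap_def sum_distrib_left)
qed

lemma lap_sym:
  assumes "\<And>i j. i < n \<Longrightarrow> j < n \<Longrightarrow> C i j = C j i"
  shows "lap n C x y = lap n C y x"
proof -
  have *: "lap n C x y = (\<Sum>i<n. \<Sum>j<n. C i j * x i * y i) - (\<Sum>i<n. \<Sum>j<n. C i j * x i * y j)" for x y
    by (simp add: lap_def sum_distrib_left sum_subtractf[symmetric] algebra_simps)
  have "(\<Sum>i<n. \<Sum>j<n. C i j * x i * y j) = (\<Sum>i<n. \<Sum>j<n. C j i * x j * y i)"
    by (rule sum.swap)
  also have "\<dots> = (\<Sum>i<n. \<Sum>j<n. C i j * y i * x j)"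
    using assms by (intro sum.cong refl) (auto simp: mult_ac)
  finally show ?thesis by (simp add: * mult_ac)
qed

section \<open>Criticality expressed through the Laplacian form\<close>

locale critical_point =
  fixes n r :: nat and C Y :: "nat \<Rightarrow> nat \<Rightarrow> real"
  assumes soc: "soc n r C Y" and sym: "\<And>i j. i < n \<Longrightarrow> j < n \<Longrightarrow> C i j = C j i"
begin

abbreviation "L \<equiv> lap n C"

text \<open>The matrices \<open>S(Y) = diag multiplier - C\<close> and
  \<open>L = diag (C 1) - C\<close> differ by \<open>diag \<tau>\<close>. Thus
  \<open>S(Y) Y = 0\<close> becomes \<open>L Y = diag \<tau> Y\<close>, where \<open>L\<close> does
  not depend on \<open>Y\<close>.\<close>

definition \<tau> :: "nat \<Rightarrow> real" where "\<tau> i = (\<Sum>j<n. C i j) - multiplier n r C Y i"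

lemma unit_rows: "i < n \<Longrightarrow> (\<Sum>l<r. (Y i l)\<^sup>2) = 1"
  using soc by (simp add: soc_def)

lemma sum_row_sq: "i < n \<Longrightarrow> (\<Sum>l<r. (c * Y i l)\<^sup>2) = c\<^sup>2"
  using unit_rows[of i] by (simp add: power_mult_distrib sum_distrib_left[symmetric])

text \<open>The first-order condition, tested against \<open>x\<close> in one column.\<close>

lemma lap_column:
  assumes "l < r"
  shows "L x (\<lambda>i. Y i l) = (\<Sum>i<n. \<tau> i * (x i * Y i l))"
proof -
  have "(\<Sum>j<n. C i j * (Y i l - Y j l)) = \<tau> i * Y i l" if "i < n" for i
    using soc that assms by (simp add: soc_def \<tau>_def right_diff_distrib sum_subtractf
        left_diff_distrib sum_distrib_right)
  then show ?thesis by (simp add: lap_def mult_ac)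
qed

lemma lap_combination:
  "L x (\<lambda>i. \<Sum>l<r. u l * Y i l) = (\<Sum>i<n. \<tau> i * (x i * (\<Sum>l<r. u l * Y i l)))"
proof -
  have "L x (\<lambda>i. \<Sum>l<r. u l * Y i l) = (\<Sum>l<r. u l * (\<Sum>i<n. \<tau> i * (x i * Y i l)))"
    by (simp add: lap_sum_right[where y="\<lambda>l i. u l * Y i l"] lap_scale_right lap_column)
  also have "\<dots> = (\<Sum>l<r. \<Sum>i<n. \<tau> i * (x i * (u l * Y i l)))"
    by (simp add: sum_distrib_left mult_ac)
  also have "\<dots> = (\<Sum>i<n. \<Sum>l<r. \<tau> i * (x i * (u l * Y i l)))"
    by (rule sum.swap)
  finally show ?thesis by (simp add: sum_distrib_left)
qed

text \<open>Summing \<open>lap_column\<close> over the columns uses up the unit norm of each row.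
  The weight 1 gives the total energy of \<open>Y\<close> as the sum of
  \<open>\<tau>\<close>.\<close>

lemma sum_lap_weighted:
  "(\<Sum>l<r. L (\<lambda>i. w i * Y i l) (\<lambda>i. Y i l)) = (\<Sum>i<n. \<tau> i * w i)"
proof -
  have "(\<Sum>l<r. L (\<lambda>i. w i * Y i l) (\<lambda>i. Y i l)) = (\<Sum>l<r. \<Sum>i<n. \<tau> i * w i * (Y i l)\<^sup>2)"
    by (simp add: lap_column power2_eq_square mult_ac)
  also have "\<dots> = (\<Sum>i<n. \<Sum>l<r. \<tau> i * w i * (Y i l)\<^sup>2)"
    by (rule sum.swap)
  also have "\<dots> = (\<Sum>i<n. \<tau> i * w i)"
    by (simp add: sum_distrib_left[symmetric] unit_rows)
  finally show ?thesis .
qed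

text \<open>The tangent vector is the projection of the constant field \<open>u\<close> onto the tangent spaces of the spheres.\<close>

lemma second_order_direction:
  fixes u :: "nat \<Rightarrow> real"
  defines "q \<equiv> (\<lambda>i. \<Sum>l<r. u l * Y i l)"
  shows "(\<Sum>l<r. (u l)\<^sup>2) * (\<Sum>l<r. L (\<lambda>i. Y i l) (\<lambda>i. Y i l))
    \<le> L q q + (\<Sum>l<r. L (\<lambda>i. q i * Y i l) (\<lambda>i. q i * Y i l))"
proof -
  define V where "V = row_proj r Y (\<lambda>i. u)"
  have V: "V i l = u l - q i * Y i l" for i l
    by (simp add: V_def row_proj_def q_def)
  have V_sq: "(\<Sum>l<r. (V i l)\<^sup>2) = (\<Sum>l<r. (u l)\<^sup>2) - (q i)\<^sup>2" if "i < n" for i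
  proof -
    have "(\<Sum>l<r. (V i l)\<^sup>2) = (\<Sum>l<r. (u l)\<^sup>2 - 2 * q i * (u l * Y i l) + (q i)\<^sup>2 * (Y i l)\<^sup>2)"
      by (rule sum.cong) (auto simp: V power2_eq_square algebra_simps)
    also have "\<dots> = (\<Sum>l<r. (u l)\<^sup>2) - 2 * q i * q i + (q i)\<^sup>2 * 1"
      unfolding sum.distrib sum_subtractf sum_distrib_left[symmetric]
      using unit_rows[OF that] by (simp add: q_def)
    finally show ?thesis by (simp add: power2_eq_square)
  qed
  \<comment> \<open>\<open>V\<close> is \<open>- q Y\<close> plus a field that does not depend on
    \<open>i\<close>, and constants lie in the kernel of \<open>L\<close>, on either side by
    symmetry.\<close>
  have lapV: "L (\<lambda>i. V i l) (\<lambda>i. V i l) = L (\<lambda>i. q i * Y i l) (\<lambda>i. q i * Y i l)" for l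
    unfolding V lap_diff_right lap_const_right
    by (subst (1 2) lap_sym[OF sym]) (auto simp: lap_diff_right lap_const_right)
  have *: "(\<Sum>l<r. L (\<lambda>i. V i l) (\<lambda>i. V i l)) =
      (\<Sum>i<n. (\<Sum>j<n. C i j) * (\<Sum>l<r. (V i l)\<^sup>2)) - (\<Sum>i<n. \<Sum>j<n. C i j * (\<Sum>l<r. V i l * V j l))"
  proof -
    have "(\<Sum>l<r. L (\<lambda>i. V i l) (\<lambda>i. V i l)) =
        (\<Sum>l<r. \<Sum>i<n. \<Sum>j<n. C i j * (V i l)\<^sup>2 - C i j * (V i l * V j l))"
      unfolding lap_def by (simp add: sum_distrib_left power2_eq_square algebra_simps)
    also have "\<dots> = (\<Sum>i<n. \<Sum>j<n. \<Sum>l<r. C i j * (V i l)\<^sup>2 - C i j * (V i l * V j l))"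
      by (simp only: sum.swap[of _ _ "{..<r}"])
    also have "\<dots> = (\<Sum>i<n. \<Sum>j<n. C i j * (\<Sum>l<r. (V i l)\<^sup>2) - C i j * (\<Sum>l<r. V i l * V j l))"
      by (simp add: sum_subtractf sum_distrib_left)
    finally show ?thesis by (simp add: sum_subtractf sum_distrib_right)
  qed
  have "(\<Sum>i<n. \<Sum>j<n. C i j * (\<Sum>l<r. V i l * V j l))
      \<le> (\<Sum>i<n. multiplier n r C Y i * (\<Sum>l<r. (V i l)\<^sup>2))"
    using soc unfolding soc_def V_def by blast
  \<comment> \<open>With the multiplier written as row sum minus \<open>\<tau>\<close>, the row sums
    complete the form in \<open>C\<close> to the energy of \<open>V\<close>.\<close>
  then have "(\<Sum>i<n. \<tau> i * (\<Sum>l<r. (V i l)\<^sup>2)) \<le> (\<Sum>l<r. L (\<lambda>i. V i l) (\<lambda>i. V i l))"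
    unfolding * by (simp add: \<tau>_def left_diff_distrib sum_subtractf)
  moreover have "(\<Sum>i<n. \<tau> i * (\<Sum>l<r. (V i l)\<^sup>2)) =
     (\<Sum>l<r. (u l)\<^sup>2) * (\<Sum>i<n. \<tau> i) - (\<Sum>i<n. \<tau> i * (q i * q i))"
  proof -
    have "(\<Sum>i<n. \<tau> i * (\<Sum>l<r. (V i l)\<^sup>2)) = (\<Sum>i<n. (\<Sum>l<r. (u l)\<^sup>2) * \<tau> i - \<tau> i * (q i * q i))"
      by (rule sum.cong) (auto simp: V_sq algebra_simps power2_eq_square[of "q _"])
    then show ?thesis by (simp add: sum_subtractf sum_distrib_left)
  qed
  moreover have "L q q = (\<Sum>i<n. \<tau> i * (q i * q i))"
    using lap_combination[of q u] by (simp add: q_def)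
  moreover have "(\<Sum>l<r. L (\<lambda>i. Y i l) (\<lambda>i. Y i l)) = (\<Sum>i<n. \<tau> i)"
    using sum_lap_weighted[of "\<lambda>_. 1"] by simp
  ultimately show ?thesis by (simp add: lapV)
qed


text \<open>Each use of criticality compares variances under the weights \<open>p\<close>, at the
  cost of the ratio \<open>\<beta> / \<alpha>\<close>. For a ratio of at most 11/10 the three
  resulting inequalities in \<open>\<mu>\<close> and \<open>s\<close> leave only
  \<open>s = 1\<close>. The total variance of the rows is \<open>1 - s^2\<close>, so it
  vanishes.\<close>

lemma rows_aligned:
  fixes p :: "nat \<Rightarrow> real" and \<alpha> \<beta> :: real
  defines "ex \<equiv> \<lambda>x. \<Sum>i<n. p i * x i"
  assumes "r \<ge> 2" and p_pos: "\<And>i. i < n \<Longrightarrow> p i > 0" and p_sum: "(\<Sum>i<n. p i) = 1"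
    and lower: "\<And>x. \<alpha> * (ex (\<lambda>i. (x i)\<^sup>2) - (ex x)\<^sup>2) \<le> L x x"
    and upper: "\<And>x. L x x \<le> \<beta> * (ex (\<lambda>i. (x i)\<^sup>2) - (ex x)\<^sup>2)"
    and "\<alpha> > 0" and \<beta>: "\<alpha> \<le> \<beta>" "\<beta> \<le> 11/10 * \<alpha>" and ij: "i < n" "j < n"
  shows "(\<Sum>l<r. Y i l * Y j l) = 1"
proof -
  have L_sym: "L x y = L y x" for x y by (rule lap_sym[OF sym])
  have ex_cong: "(\<And>i. i < n \<Longrightarrow> x i = y i) \<Longrightarrow> ex x = ex y" for x y
    by (simp add: ex_def)
  have ex_add: "ex (\<lambda>i. x i + y i) = ex x + ex y" for x y
    by (simp add: ex_def distrib_left sum.distrib)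
  have ex_diff: "ex (\<lambda>i. x i - y i) = ex x - ex y" for x y
    by (simp add: ex_def right_diff_distrib sum_subtractf)
  have ex_scale: "ex (\<lambda>i. c * x i) = c * ex x" for c x
    by (simp add: ex_def sum_distrib_left mult_ac)
  have ex_const: "ex (\<lambda>i. c) = c" for c
    using p_sum by (simp add: ex_def sum_distrib_right[symmetric])
  have ex_sum: "ex (\<lambda>i. \<Sum>k\<in>A. x k i) = (\<Sum>k\<in>A. ex (x k))" for A :: "nat set" and x
    by (simp add: ex_def sum_distrib_left sum.swap[of _ A])
  have ex_mono: "(\<And>i. i < n \<Longrightarrow> x i \<le> y i) \<Longrightarrow> ex x \<le> ex y" for x y
    unfolding ex_def by (intro sum_mono mult_left_mono) (auto intro: less_imp_le p_pos)
  have ex_nonneg: "(\<And>i. 0 \<le> x i) \<Longrightarrow> 0 \<le> ex x" for x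
    using ex_mono[of "\<lambda>_. 0" x] ex_const[of 0] by simp
  have var: "ex (\<lambda>i. (x i)\<^sup>2) - (ex x)\<^sup>2 = ex (\<lambda>i. (x i - ex x)\<^sup>2)" for x
  proof -
    have "ex (\<lambda>i. (x i - ex x)\<^sup>2) = ex (\<lambda>i. (x i)\<^sup>2 - 2 * ex x * x i + (ex x)\<^sup>2)"
      by (simp add: power2_eq_square algebra_simps)
    then show ?thesis unfolding ex_add ex_diff ex_scale ex_const by (simp add: power2_eq_square)
  qed
  have L_nonneg: "0 \<le> L x x" for x
    using lower[of x] ex_nonneg[of "\<lambda>i. (x i - ex x)\<^sup>2"] \<open>\<alpha> > 0\<close> var[of x]
    by (smt (verit) mult_nonneg_nonneg zero_le_power2)
  have \<beta>_pos: "\<beta> > 0" using \<open>\<alpha> > 0\<close> \<beta> by linarith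

  define m where "m l = ex (\<lambda>i. Y i l)" for l
  define s where "s = sqrt (\<Sum>l<r. (m l)\<^sup>2)"
  have s_nonneg: "s \<ge> 0" and s_sq: "s\<^sup>2 = (\<Sum>l<r. (m l)\<^sup>2)"
    by (auto simp: s_def sum_nonneg)
  \<comment> \<open>If the rows average to zero, no direction is distinguished and the first basis
    vector serves as default. In either case \<open>e\<close> is a unit vector and
    \<open>m = s e\<close>.\<close>
  define e where "e l = (if s = 0 then (if l = 0 then 1 else 0) else m l / s)" for l :: nat
  have m_e: "m l = s * e l" if "l < r" for l
  proof (cases "s = 0")
    case True
    then have "(\<Sum>l<r. (m l)\<^sup>2) = 0" using s_sq by simp
    then have "(m l)\<^sup>2 = 0" using that
      by (subst (asm) sum_nonneg_eq_0_iff) auto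
    with True show ?thesis by simp
  qed (simp add: e_def)
  have e_sq: "(\<Sum>l<r. (e l)\<^sup>2) = 1"
  proof (cases "s = 0")
    case True
    then have "(e l)\<^sup>2 = (if l = 0 then 1 else 0)" for l by (simp add: e_def)
    then show ?thesis using \<open>r \<ge> 2\<close> by simp
  next
    case False
    then have "s\<^sup>2 \<noteq> 0" by simp
    with False show ?thesis
      by (simp add: e_def power_divide sum_divide_distrib[symmetric] s_sq[symmetric])
  qed
  define a where "a i = (\<Sum>l<r. e l * Y i l)" for i
  define b where "b l i = Y i l - e l * a i" for l i
  define \<mu> where "\<mu> = ex (\<lambda>i. (a i)\<^sup>2)"
  have ex_a: "ex a = s"
  proof -
    have "ex a = (\<Sum>l<r. e l * m l)"
      unfolding a_def by (simp add: ex_sum[where x="\<lambda>l i. e l * Y i l"] ex_scale m_def)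
    also have "\<dots> = (\<Sum>l<r. s * (e l)\<^sup>2)"
      by (rule sum.cong) (auto simp: m_e power2_eq_square)
    finally show ?thesis by (simp add: sum_distrib_left[symmetric] e_sq)
  qed
  \<comment> \<open>The mean is a multiple of \<open>e\<close>, so the part of the rows orthogonal
    to \<open>e\<close> is centered and its variance is its second moment.\<close>
  have ex_b: "ex (b l) = 0" if "l < r" for l
    using m_e[OF that] unfolding b_def[abs_def] ex_diff ex_scale ex_a m_def by simp
  have b_sq: "(\<Sum>l<r. (b l i)\<^sup>2) = 1 - (a i)\<^sup>2" if "i < n" for i
  proof -
    have "(\<Sum>l<r. (b l i)\<^sup>2) = (\<Sum>l<r. (Y i l)\<^sup>2 - 2 * a i * (e l * Y i l) + (a i)\<^sup>2 * (e l)\<^sup>2)"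
      by (rule sum.cong) (auto simp: b_def power2_eq_square algebra_simps)
    also have "\<dots> = 1 - 2 * a i * a i + (a i)\<^sup>2 * 1"
      unfolding sum.distrib sum_subtractf sum_distrib_left[symmetric] unit_rows[OF that] e_sq
      by (simp flip: a_def)
    finally show ?thesis by (simp add: power2_eq_square)
  qed
  have ex_b_sq: "(\<Sum>l<r. ex (\<lambda>i. (b l i)\<^sup>2)) = 1 - \<mu>"
    unfolding ex_sum[symmetric] by (simp add: b_sq \<mu>_def ex_diff ex_const cong: ex_cong)
  have \<mu>_le: "\<mu> \<le> 1"
    using ex_b_sq sum_nonneg[of "{..<r}" "\<lambda>l. ex (\<lambda>i. (b l i)\<^sup>2)"] ex_nonneg by fastforce
  have s_\<mu>: "s\<^sup>2 \<le> \<mu>"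
    using var[of a] ex_nonneg[of "\<lambda>i. (a i - ex a)\<^sup>2"] by (simp add: ex_a \<mu>_def)
  define E where "E = (\<Sum>l<r. L (\<lambda>i. Y i l) (\<lambda>i. Y i l))"
  \<comment> \<open>Pythagoras for energies: the component along \<open>e\<close> carries
    \<open>L a a\<close>, the orthogonal part carries the rest of \<open>E\<close>.\<close>
  have lap_b: "(\<Sum>l<r. L (b l) (b l)) = E - L a a"
  proof -
    have "(\<Sum>l<r. e l * L a (\<lambda>i. Y i l)) = L a (\<lambda>i. \<Sum>l<r. e l * Y i l)"
      by (simp add: lap_sum_right[where y="\<lambda>l i. e l * Y i l"] lap_scale_right)
    then have *: "(\<Sum>l<r. e l * L a (\<lambda>i. Y i l)) = L a a" by (simp flip: a_def)
    have "L (b l) (b l) = L (\<lambda>i. Y i l) (\<lambda>i. Y i l) - 2 * (e l * L a (\<lambda>i. Y i l)) + (e l)\<^sup>2 * L a a" for l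
      unfolding b_def lap_diff_left lap_diff_right lap_scale_left lap_scale_right
      using L_sym[of a "\<lambda>i. Y i l"] by (simp add: power2_eq_square algebra_simps)
    then show ?thesis
      by (simp add: sum.distrib sum_subtractf * e_sq E_def flip: sum_distrib_left sum_distrib_right)
  qed

  \<comment> \<open>second-order condition in the direction \<open>e\<close> of the mean\<close>
  have "1 - \<mu> \<le> 11/10 * (\<mu> * (1 - \<mu>))"
  proof -
    have "E \<le> L a a + (\<Sum>l<r. L (\<lambda>i. a i * Y i l) (\<lambda>i. a i * Y i l))"
      using second_order_direction[of e] unfolding e_sq E_def[symmetric] a_def[symmetric] by simp
    moreover have "\<alpha> * (1 - \<mu>) \<le> (\<Sum>l<r. L (b l) (b l))"
    proof -
      have "\<alpha> * ex (\<lambda>i. (b l i)\<^sup>2) \<le> L (b l) (b l)" if "l < r" for l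
        using lower[of "b l"] ex_b[OF that] by simp
      then have "(\<Sum>l<r. \<alpha> * ex (\<lambda>i. (b l i)\<^sup>2)) \<le> (\<Sum>l<r. L (b l) (b l))"
        by (intro sum_mono) auto
      then show ?thesis by (simp add: ex_b_sq flip: sum_distrib_left)
    qed
    moreover have "(\<Sum>l<r. L (\<lambda>i. a i * Y i l) (\<lambda>i. a i * Y i l)) \<le> \<beta> * (\<mu> - \<mu>\<^sup>2)"
    proof -
      \<comment> \<open>The mean of the field \<open>a Y\<close> has component \<open>\<mu>\<close>
        along \<open>e\<close>, so its squared norm is at least \<open>\<mu>^2\<close>. Keeping this
        term of the variance produces the factor \<open>1 - \<mu>\<close>.\<close>
      let ?w = "\<lambda>l. ex (\<lambda>i. a i * Y i l)"
      have "(\<Sum>l<r. e l * ?w l) = ex (\<lambda>i. \<Sum>l<r. e l * (a i * Y i l))"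
        by (simp add: ex_sum[where x="\<lambda>l i. e l * (a i * Y i l)"] ex_scale)
      also have "\<dots> = ex (\<lambda>i. (a i)\<^sup>2)"
        by (intro ex_cong) (simp add: a_def power2_eq_square sum_distrib_left mult_ac)
      finally have "(\<Sum>l<r. e l * ?w l) = \<mu>" by (simp add: \<mu>_def)
      then have CS: "\<mu>\<^sup>2 \<le> (\<Sum>l<r. (?w l)\<^sup>2)"
        using Cauchy_Schwarz_ineq_sum[of e ?w "{..<r}"] e_sq by simp
      have "(\<Sum>l<r. ex (\<lambda>i. (a i * Y i l)\<^sup>2)) = ex (\<lambda>i. (a i)\<^sup>2)"
        unfolding ex_sum[symmetric] by (rule ex_cong) (rule sum_row_sq)
      then have sq: "(\<Sum>l<r. ex (\<lambda>i. (a i * Y i l)\<^sup>2)) = \<mu>" by (simp add: \<mu>_def)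
      have "(\<Sum>l<r. L (\<lambda>i. a i * Y i l) (\<lambda>i. a i * Y i l))
          \<le> (\<Sum>l<r. \<beta> * (ex (\<lambda>i. (a i * Y i l)\<^sup>2) - (?w l)\<^sup>2))"
        by (intro sum_mono upper)
      also have "\<dots> = \<beta> * (\<mu> - (\<Sum>l<r. (?w l)\<^sup>2))"
        by (simp add: sq sum_subtractf flip: sum_distrib_left)
      also have "\<dots> \<le> \<beta> * (\<mu> - \<mu>\<^sup>2)"
        using CS \<beta>_pos by (intro mult_left_mono) auto
      finally show ?thesis .
    qed
    moreover have "0 \<le> \<mu> - \<mu>\<^sup>2"
      using mult_nonneg_nonneg[of \<mu> "1 - \<mu>"] \<mu>_le order_trans[OF zero_le_power2 s_\<mu>]
      by (simp add: power2_eq_square algebra_simps)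
    then have "\<beta> * (\<mu> - \<mu>\<^sup>2) \<le> 11/10 * \<alpha> * (\<mu> - \<mu>\<^sup>2)"
      using \<beta> by (intro mult_right_mono)
    ultimately have "\<alpha> * (1 - \<mu>) \<le> \<alpha> * (11/10 * (\<mu> * (1 - \<mu>)))"
      using lap_b by (simp add: power2_eq_square algebra_simps)
    then show ?thesis using \<open>\<alpha> > 0\<close> by simp
  qed
  \<comment> \<open>second-order condition summed over the coordinate directions projected orthogonally to \<open>e\<close>\<close>
  moreover have "\<mu> - s\<^sup>2 \<le> 11/10 * (1 - \<mu>)"
  proof -
    \<comment> \<open>\<open>u k\<close> is row \<open>k\<close> of the projection
      \<open>I - e e^T\<close>; the squared norms of the rows add up to its trace
      \<open>r - 1\<close>.\<close>
    define u where "u k l = (if l = k then 1 else 0) - e k * e l" for k l :: nat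
    have u_Y: "(\<Sum>l<r. u k l * Y i l) = b k i" if "k < r" for k i
    proof -
      have "(\<Sum>l<r. u k l * Y i l) = (\<Sum>l<r. (if l = k then Y i l else 0) - e k * (e l * Y i l))"
        by (rule sum.cong) (auto simp: u_def algebra_simps)
      then show ?thesis using that by (simp add: sum_subtractf b_def a_def flip: sum_distrib_left)
    qed
    have "(\<Sum>l<r. (u k l)\<^sup>2) = 1 - (e k)\<^sup>2" if "k < r" for k
    proof -
      have "(u k l)\<^sup>2 = (if l = k then 1 - 2 * e k * e l else 0) + (e k)\<^sup>2 * (e l)\<^sup>2" for l
        by (auto simp: u_def power2_eq_square algebra_simps)
      then have "(\<Sum>l<r. (u k l)\<^sup>2) = 1 - 2 * e k * e k + (e k)\<^sup>2 * 1"
        using that by (simp add: sum.distrib e_sq flip: sum_distrib_left)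
      then show ?thesis by (simp add: power2_eq_square)
    qed
    then have u_sq: "(\<Sum>k<r. \<Sum>l<r. (u k l)\<^sup>2) = real r - 1"
      by (simp add: sum_subtractf e_sq)
    have "(\<Sum>k<r. (\<Sum>l<r. (u k l)\<^sup>2) * E)
        \<le> (\<Sum>k<r. L (b k) (b k) + (\<Sum>l<r. L (\<lambda>i. b k i * Y i l) (\<lambda>i. b k i * Y i l)))"
    proof (rule sum_mono)
      fix k assume "k \<in> {..<r}"
      then have "k < r" by simp
      show "(\<Sum>l<r. (u k l)\<^sup>2) * E
          \<le> L (b k) (b k) + (\<Sum>l<r. L (\<lambda>i. b k i * Y i l) (\<lambda>i. b k i * Y i l))"
        using second_order_direction[of "u k"] unfolding u_Y[OF \<open>k < r\<close>] E_def by simp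
    qed
    also have "\<dots> = E - L a a + (\<Sum>k<r. \<Sum>l<r. L (\<lambda>i. b k i * Y i l) (\<lambda>i. b k i * Y i l))"
      by (simp add: sum.distrib lap_b)
    also have "(\<Sum>k<r. (\<Sum>l<r. (u k l)\<^sup>2) * E) = (real r - 1) * E"
      by (simp add: u_sq flip: sum_distrib_right)
    finally have *: "(real r - 1) * E \<le> E - L a a
      + (\<Sum>k<r. \<Sum>l<r. L (\<lambda>i. b k i * Y i l) (\<lambda>i. b k i * Y i l))" .
    have "E \<ge> 0" by (auto simp: E_def intro: sum_nonneg L_nonneg)
    \<comment> \<open>Here \<open>r \<ge> 2\<close> enters: some direction orthogonal to
      \<open>e\<close> exists. One copy of \<open>E\<close> then cancels on both sides and a bound
      on \<open>L a a\<close> remains.\<close>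
    then have "E \<le> (real r - 1) * E"
      using \<open>r \<ge> 2\<close> mult_right_mono[of 1 "real r - 1" E] by simp
    with * have "L a a \<le> (\<Sum>k<r. \<Sum>l<r. L (\<lambda>i. b k i * Y i l) (\<lambda>i. b k i * Y i l))"
      by linarith
    also have "\<dots> \<le> (\<Sum>k<r. \<Sum>l<r. \<beta> * ex (\<lambda>i. (b k i * Y i l)\<^sup>2))"
      using \<beta>_pos by (intro sum_mono order_trans[OF upper] mult_left_mono) auto
    also have "\<dots> = \<beta> * (\<Sum>k<r. ex (\<lambda>i. \<Sum>l<r. (b k i * Y i l)\<^sup>2))"
      by (simp add: ex_sum[where x="\<lambda>l i. (b _ i * Y i l)\<^sup>2"] sum_distrib_left)
    also have "\<dots> = \<beta> * (1 - \<mu>)"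
      by (simp add: sum_row_sq ex_b_sq cong: ex_cong)
    also have "\<dots> \<le> 11/10 * \<alpha> * (1 - \<mu>)"
      using \<beta> \<mu>_le by (intro mult_right_mono) auto
    finally have "L a a \<le> \<alpha> * (11/10 * (1 - \<mu>))" by (simp add: algebra_simps)
    moreover have "\<alpha> * (\<mu> - s\<^sup>2) \<le> L a a"
      using lower[of a] by (simp add: ex_a \<mu>_def)
    ultimately have "\<alpha> * (\<mu> - s\<^sup>2) \<le> \<alpha> * (11/10 * (1 - \<mu>))" by linarith
    then show ?thesis using \<open>\<alpha> > 0\<close> by simp
  qed
  \<comment> \<open>first-order condition, using that \<open>\<tau>\<close> is orthogonal to \<open>a\<close>\<close>
  moreover have "1 - s\<^sup>2 \<le> 11/10 * (1 - 2 * s + \<mu>)"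
  proof -
    let ?y = "\<lambda>l i. Y i l" and ?x = "\<lambda>l i. (1 - a i) * Y i l"
    \<comment> \<open>By symmetry \<open>L\<close> annihilates constants in the first argument too.
      The weight 1 in the sum of \<open>\<tau>\<close> may therefore be replaced by
      \<open>1 - a\<close>, which is small near alignment.\<close>
    have "(\<Sum>i<n. \<tau> i * a i) = L (\<lambda>i. 1) a"
      using lap_combination[of "\<lambda>_. 1" e] by (simp flip: a_def)
    also have "\<dots> = 0" using L_sym[of "\<lambda>i. 1" a] by (simp add: lap_const_right)
    finally have "(\<Sum>i<n. \<tau> i * (1 - a i)) = (\<Sum>i<n. \<tau> i * 1)"
      by (simp add: right_diff_distrib sum_subtractf)
    then have E_eq: "E = (\<Sum>l<r. L (?x l) (?y l))"
      using sum_lap_weighted[of "\<lambda>_. 1"] sum_lap_weighted[of "\<lambda>i. 1 - a i"] by (simp add: E_def)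
    \<comment> \<open>Positive semidefiniteness at \<open>x - y\<close>. After summation half of
      \<open>E\<close> is absorbed on the left.\<close>
    have "L (?x l) (?y l) \<le> (L (?x l) (?x l) + L (?y l) (?y l)) / 2" for l
      using L_nonneg[of "\<lambda>i. ?x l i - ?y l i"] L_sym[of "?x l" "?y l"]
      unfolding lap_diff_left lap_diff_right by simp
    then have "E \<le> (\<Sum>l<r. (L (?x l) (?x l) + L (?y l) (?y l)) / 2)"
      unfolding E_eq by (intro sum_mono)
    also have "\<dots> = ((\<Sum>l<r. L (?x l) (?x l)) + E) / 2"
      by (simp add: E_def sum.distrib flip: sum_divide_distrib)
    finally have "E \<le> (\<Sum>l<r. L (?x l) (?x l))" by simp
    also have "\<dots> \<le> (\<Sum>l<r. \<beta> * ex (\<lambda>i. (?x l i)\<^sup>2))"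
      using \<beta>_pos by (intro sum_mono order_trans[OF upper] mult_left_mono) auto
    also have "\<dots> = \<beta> * ex (\<lambda>i. \<Sum>l<r. (?x l i)\<^sup>2)"
      by (simp add: ex_sum[where x="\<lambda>l i. (?x l i)\<^sup>2"] sum_distrib_left)
    also have "ex (\<lambda>i. \<Sum>l<r. (?x l i)\<^sup>2) = ex (\<lambda>i. 1 - 2 * a i + (a i)\<^sup>2)"
      by (rule ex_cong) (simp only: sum_row_sq, simp add: power2_eq_square algebra_simps)
    also have "\<dots> = 1 - 2 * s + \<mu>"
      unfolding ex_add ex_diff ex_scale ex_const ex_a \<mu>_def ..
    finally have "E \<le> \<beta> * (1 - 2 * s + \<mu>)" .
    also have "\<dots> \<le> 11/10 * \<alpha> * (1 - 2 * s + \<mu>)"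
    proof (rule mult_right_mono)
      have "0 \<le> (1 - s)\<^sup>2" by simp
      also have "\<dots> = 1 - 2 * s + s\<^sup>2" by (simp add: power2_eq_square algebra_simps)
      also have "\<dots> \<le> 1 - 2 * s + \<mu>" using s_\<mu> by simp
      finally show "0 \<le> 1 - 2 * s + \<mu>" .
    qed (use \<beta> in simp)
    finally have "E \<le> \<alpha> * (11/10 * (1 - 2 * s + \<mu>))" by (simp add: algebra_simps)
    moreover have "\<alpha> * (1 - s\<^sup>2) \<le> E"
    proof -
      have "(\<Sum>l<r. \<alpha> * (ex (\<lambda>i. (Y i l)\<^sup>2) - (m l)\<^sup>2)) \<le> E"
        unfolding E_def m_def by (intro sum_mono lower)
      moreover have "(\<Sum>l<r. ex (\<lambda>i. (Y i l)\<^sup>2)) = 1"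
        unfolding ex_sum[symmetric] by (simp add: unit_rows ex_const cong: ex_cong)
      ultimately show ?thesis by (simp add: s_sq sum_subtractf flip: sum_distrib_left)
    qed
    ultimately have "\<alpha> * (1 - s\<^sup>2) \<le> \<alpha> * (11/10 * (1 - 2 * s + \<mu>))" by linarith
    then show ?thesis using \<open>\<alpha> > 0\<close> by simp
  qed
  ultimately have "s = 1"
  proof -
    assume 1: "1 - \<mu> \<le> 11/10 * (\<mu> * (1 - \<mu>))" and 2: "\<mu> - s\<^sup>2 \<le> 11/10 * (1 - \<mu>)"
      and 3: "1 - s\<^sup>2 \<le> 11/10 * (1 - 2 * s + \<mu>)"
    have s_le: "s \<le> 1" using s_\<mu> \<mu>_le power2_le_imp_le[of s 1] by simp
    \<comment> \<open>The first inequality says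
      \<open>(1 - \<mu>) (1 - 11/10 \<mu>) \<le> 0\<close>, and below 10/11 both factors are
      positive.\<close>
    have "\<mu> \<ge> 10/11"
    proof (rule ccontr)
      assume "\<not> ?thesis"
      then have "0 < (1 - \<mu>) * (1 - 11/10 * \<mu>)" by (intro mult_pos_pos) auto
      moreover have "(1 - \<mu>) * (1 - 11/10 * \<mu>) = 1 - \<mu> - 11/10 * (\<mu> * (1 - \<mu>))"
        by (simp add: algebra_simps)
      ultimately show False using 1 by linarith
    qed
    with 2 have "(8/10)\<^sup>2 < s\<^sup>2" by (simp add: power2_eq_square)
    then have "8/10 < s" using s_nonneg power2_less_imp_less by blast
    show "s = 1"
    proof (rule ccontr)
      assume "s \<noteq> 1"
      \<comment> \<open>The second inequality, solved for \<open>\<mu>\<close> and inserted into the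
        third, leaves a quadratic in \<open>s\<close> with roots 71/160 and 1. It is negative
        between them, and \<open>s > 8/10\<close> lies beyond the smaller root.\<close>
      have "\<mu> \<le> (11 + 10 * s\<^sup>2) / 21" using 2 by simp
      then have "11/10 * (1 - 2 * s + \<mu>) \<le> 11/10 * (1 - 2 * s + (11 + 10 * s\<^sup>2) / 21)"
        by (intro mult_left_mono) auto
      with 3 have "1 - s\<^sup>2 \<le> 11/10 * (1 - 2 * s + (11 + 10 * s\<^sup>2) / 21)" by (rule order_trans)
      moreover have "11/10 * (1 - 2 * s + (11 + 10 * s\<^sup>2) / 21) - (1 - s\<^sup>2) =
          (1 - s) * (142/210 - 320/210 * s)"
        by (simp add: power2_eq_square field_simps)
      moreover have "(1 - s) * (142/210 - 320/210 * s) < 0"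
        using \<open>s \<noteq> 1\<close> s_le \<open>8/10 < s\<close> by (intro mult_pos_neg) auto
      ultimately show False by linarith
    qed
  qed
  have "ex (\<lambda>i. \<Sum>l<r. (Y i l - m l)\<^sup>2) = (\<Sum>l<r. ex (\<lambda>i. (Y i l)\<^sup>2) - (m l)\<^sup>2)"
    unfolding ex_sum[where x="\<lambda>l i. (Y i l - m l)\<^sup>2"] by (simp add: m_def var)
  also have "\<dots> = 0"
    unfolding sum_subtractf ex_sum[symmetric] s_sq[symmetric] \<open>s = 1\<close>
    by (simp add: unit_rows ex_const cong: ex_cong)
  finally have "(\<Sum>i<n. p i * (\<Sum>l<r. (Y i l - m l)\<^sup>2)) = 0" by (simp add: ex_def)
  then have "p i * (\<Sum>l<r. (Y i l - m l)\<^sup>2) = 0" if "i < n" for i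
    using that by (subst (asm) sum_nonneg_eq_0_iff) (auto intro!: mult_nonneg_nonneg sum_nonneg simp: less_imp_le[OF p_pos])
  then have "(\<Sum>l<r. (Y i l - m l)\<^sup>2) = 0" if "i < n" for i
    using p_pos[OF that] that by force
  then have "Y i l = m l" if "i < n" "l < r" for i l
    using that by (subst (asm) sum_nonneg_eq_0_iff) auto
  then have "(\<Sum>l<r. Y i l * Y j l) = (\<Sum>l<r. (m l)\<^sup>2)"
    using ij by (simp add: power2_eq_square)
  then show ?thesis using s_sq \<open>s = 1\<close> by simp
qed

end

section \<open>Riemannian criticality in coordinates\<close>

lemma mat_inner_sum:
  assumes "A \<in> carrier_mat n m" "B \<in> carrier_mat n m"
  shows "mat_inner A B = (\<Sum>i<n. \<Sum>j<m. A $$ (i, j) * B $$ (i, j))"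
proof -
  have "mat_inner A B = (\<Sum>j<m. (transpose_mat A * B) $$ (j, j))"
    using assms by (simp add: mat_inner_def diag_mat_def sum_set_upt_conv_sum_list_nat[symmetric] atLeast0LessThan)
  also have "\<dots> = (\<Sum>j<m. \<Sum>i<n. A $$ (i, j) * B $$ (i, j))"
    using assms by (intro sum.cong) (auto simp: scalar_prod_def atLeast0LessThan)
  finally show ?thesis by (simp only: sum.swap[of _ "{..<n}"])
qed

lemma mult_transpose_entry:
  assumes "X \<in> carrier_mat n r" "Z \<in> carrier_mat n r" "i < n" "j < n"
  shows "(X * transpose_mat Z) $$ (i, j) = (\<Sum>l<r. X $$ (i, l) * Z $$ (j, l))"
  using assms by (auto simp: scalar_prod_def atLeast0LessThan)

lemma tangent_proj_carrier:
  assumes "Y \<in> carrier_mat n r" "Z \<in> carrier_mat n r"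
  shows "tangent_proj Y Z \<in> carrier_mat n r"
  using assms by (auto simp: tangent_proj_def ddiag_def mat_diag_def)

lemma tangent_proj_entry:
  assumes "Y \<in> carrier_mat n r" "Z \<in> carrier_mat n r" "i < n" "l < r"
  shows "tangent_proj Y Z $$ (i, l) = row_proj r (\<lambda>i l. Y $$ (i, l)) (\<lambda>i l. Z $$ (i, l)) i l"
proof -
  have "mat_diag n (\<lambda>i. (Z * transpose_mat Y) $$ (i, i)) * Y
      = Matrix.mat n r (\<lambda>(i, j). (Z * transpose_mat Y) $$ (i, i) * Y $$ (i, j))"
    by (rule mat_diag_mult_left[OF assms(1)])
  then have "(ddiag (Z * transpose_mat Y) * Y) $$ (i, l) = (Z * transpose_mat Y) $$ (i, i) * Y $$ (i, l)"
    using assms by (simp add: ddiag_def)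
  moreover have "dim_row (ddiag (Z * transpose_mat Y)) = n"
    using assms by (auto simp: ddiag_def mat_diag_def)
  ultimately show ?thesis
    using assms mult_transpose_entry[OF assms(2,1) \<open>i < n\<close> \<open>i < n\<close>]
    by (simp add: tangent_proj_def row_proj_def)
qed

lemma sphere_product_iff:
  "Y \<in> sphere_product n r \<longleftrightarrow> Y \<in> carrier_mat n r \<and> (\<forall>i<n. (\<Sum>l<r. (Y $$ (i, l))\<^sup>2) = 1)"
proof -
  have "diag_mat (Y * transpose_mat Y) = replicate n 1 \<longleftrightarrow> (\<forall>i<n. (\<Sum>l<r. (Y $$ (i, l))\<^sup>2) = 1)"
    if "Y \<in> carrier_mat n r"
    using that mult_transpose_entry[OF that that]
    by (auto simp: list_eq_iff_nth_eq diag_mat_def power2_eq_square)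
  then show ?thesis by (auto simp: sphere_product_def)
qed

lemma tangent_space_iff:
  assumes "Y \<in> carrier_mat n r"
  shows "V \<in> tangent_space Y \<longleftrightarrow>
    V \<in> carrier_mat n r \<and> (\<forall>i<n. (\<Sum>l<r. V $$ (i, l) * Y $$ (i, l)) = 0)"
proof -
  have "diag_mat (Y * transpose_mat V) = replicate n 0 \<longleftrightarrow> (\<forall>i<n. (\<Sum>l<r. V $$ (i, l) * Y $$ (i, l)) = 0)"
    if "V \<in> carrier_mat n r"
    using that assms mult_transpose_entry[OF assms that]
    by (auto simp: list_eq_iff_nth_eq diag_mat_def mult.commute)
  then show ?thesis using assms by (auto simp: tangent_space_def)
qed

section \<open>Gradient and Hessian of the quadratic objective\<close>

context
  fixes n r :: nat and C :: "real mat" and f :: "real mat \<Rightarrow> real" and c :: "nat \<Rightarrow> nat \<Rightarrow> real"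
  assumes C: "C \<in> carrier_mat n n" and C_sym: "transpose_mat C = C"
  defines "f \<equiv> \<lambda>X. mat_inner C (X * transpose_mat X)"
    and "c \<equiv> \<lambda>i j. C $$ (i, j)"
begin

lemma c_sym: "i < n \<Longrightarrow> j < n \<Longrightarrow> c i j = c j i"
  using C C_sym unfolding c_def by (metis carrier_matD index_transpose_mat(1))

lemma objective_sum:
  assumes "X \<in> carrier_mat n r"
  shows "f X = (\<Sum>a<n. \<Sum>b<n. c a b * (\<Sum>l<r. X $$ (a, l) * X $$ (b, l)))"
proof -
  have "X * transpose_mat X \<in> carrier_mat n n" using assms by auto
  from mat_inner_sum[OF C this] show ?thesis
    using mult_transpose_entry[OF assms assms] by (simp add: f_def c_def)
qed

text \<open>The product rule gives two terms that agree by symmetry of \<open>C\<close>, hence the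
  factor 2. Elementary matrices as directions then yield the Euclidean gradient
  \<open>2 C X\<close>.\<close>

lemma objective_directional:
  assumes X: "X \<in> carrier_mat n r"
  shows "((\<lambda>t. f (X + t \<cdot>\<^sub>m Matrix.mat n r h)) has_real_derivative
    2 * (\<Sum>a<n. \<Sum>l<r. h (a, l) * (\<Sum>b<n. c a b * X $$ (b, l)))) (at 0)"
proof -
  have eq: "f (X + t \<cdot>\<^sub>m Matrix.mat n r h) = (\<Sum>a<n. \<Sum>b<n. c a b *
      (\<Sum>l<r. (X $$ (a, l) + t * h (a, l)) * (X $$ (b, l) + t * h (b, l))))" for t
    using X by (subst objective_sum) auto
  have "((\<lambda>t. f (X + t \<cdot>\<^sub>m Matrix.mat n r h)) has_real_derivative
      (\<Sum>a<n. \<Sum>b<n. c a b * (\<Sum>l<r. h (a, l) * X $$ (b, l) + X $$ (a, l) * h (b, l)))) (at 0)"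
    unfolding eq by (auto intro!: derivative_eq_intros sum.cong simp: mult_ac)
  also have "(\<Sum>a<n. \<Sum>b<n. c a b * (\<Sum>l<r. h (a, l) * X $$ (b, l) + X $$ (a, l) * h (b, l)))
      = (\<Sum>a<n. \<Sum>b<n. c a b * (\<Sum>l<r. h (a, l) * X $$ (b, l)))
        + (\<Sum>a<n. \<Sum>b<n. c a b * (\<Sum>l<r. X $$ (a, l) * h (b, l)))"
    by (simp add: sum.distrib distrib_left)
  also have "(\<Sum>a<n. \<Sum>b<n. c a b * (\<Sum>l<r. X $$ (a, l) * h (b, l)))
      = (\<Sum>b<n. \<Sum>a<n. c a b * (\<Sum>l<r. X $$ (a, l) * h (b, l)))"
    by (rule sum.swap)
  also have "\<dots> = (\<Sum>a<n. \<Sum>b<n. c a b * (\<Sum>l<r. h (a, l) * X $$ (b, l)))"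
    by (intro sum.cong refl) (auto simp: c_sym mult_ac)
  also have "(\<Sum>a<n. \<Sum>b<n. c a b * (\<Sum>l<r. h (a, l) * X $$ (b, l)))
      = (\<Sum>a<n. \<Sum>l<r. h (a, l) * (\<Sum>b<n. c a b * X $$ (b, l)))"
    by (simp add: sum_distrib_left sum.swap[of _ "{..<r}"] mult_ac)
  finally show ?thesis by simp
qed

lemma euclidean_grad_objective:
  assumes X: "X \<in> carrier_mat n r"
  shows "euclidean_grad f X = Matrix.mat n r (\<lambda>(i, l). 2 * (\<Sum>b<n. c i b * X $$ (b, l)))"
proof (rule eq_matI)
  fix i l assume "i < dim_row (Matrix.mat n r (\<lambda>(i, l). 2 * (\<Sum>b<n. c i b * X $$ (b, l))))"
    "l < dim_col (Matrix.mat n r (\<lambda>(i, l). 2 * (\<Sum>b<n. c i b * X $$ (b, l))))"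
  then have il: "i < n" "l < r" by auto
  let ?h = "\<lambda>(a, k). if a = i \<and> k = l then 1 else (0::real)"
  have "(\<Sum>k<r. ?h (a, k) * g k) = (if a = i then g l else 0)" for a and g :: "nat \<Rightarrow> real"
    using il by (cases "a = i") (simp_all add: if_distrib[of "\<lambda>u. u * x" for x] cong: if_cong)
  then have "(\<Sum>a<n. \<Sum>k<r. ?h (a, k) * (\<Sum>b<n. c a b * X $$ (b, k))) = (\<Sum>b<n. c i b * X $$ (b, l))"
    using il by simp
  then show "euclidean_grad f X $$ (i, l) =
      Matrix.mat n r (\<lambda>(i, l). 2 * (\<Sum>b<n. c i b * X $$ (b, l))) $$ (i, l)"
    using X il DERIV_imp_deriv[OF objective_directional[OF X, of ?h]]
    by (simp add: euclidean_grad_def)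
qed (use X in \<open>auto simp: euclidean_grad_def\<close>)

lemma riemannian_grad_carrier: "X \<in> carrier_mat n r \<Longrightarrow> riemannian_grad f X \<in> carrier_mat n r"
  unfolding riemannian_grad_def
  by (rule tangent_proj_carrier) (auto simp: euclidean_grad_objective)

lemma riemannian_grad_entry:
  assumes X: "X \<in> carrier_mat n r" and "i < n" "l < r"
  shows "riemannian_grad f X $$ (i, l) = 2 * (\<Sum>b<n. c i b * X $$ (b, l))
    - (\<Sum>k<r. 2 * (\<Sum>b<n. c i b * X $$ (b, k)) * X $$ (i, k)) * X $$ (i, l)"
  unfolding riemannian_grad_def using assms
  by (subst tangent_proj_entry[OF X]) (auto simp: euclidean_grad_objective row_proj_def)

lemma multiplier_eq:
  "(\<Sum>k<r. 2 * (\<Sum>b<n. c i b * X $$ (b, k)) * X $$ (i, k)) = 2 * multiplier n r c (\<lambda>i l. X $$ (i, l)) i"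
  by (simp add: multiplier_def sum_distrib_left sum_distrib_right sum.swap[of _ "{..<r}"] mult_ac)

lemma riemannian_grad_eq_0_iff:
  assumes X: "X \<in> carrier_mat n r"
  shows "riemannian_grad f X = 0\<^sub>m n r \<longleftrightarrow>
    (\<forall>i<n. \<forall>l<r. (\<Sum>j<n. c i j * X $$ (j, l)) = multiplier n r c (\<lambda>i l. X $$ (i, l)) i * X $$ (i, l))"
  using riemannian_grad_carrier[OF X]
  by (auto simp: mat_eq_iff riemannian_grad_entry[OF X] multiplier_eq)

text \<open>The gradient field is \<open>2 (C Y - diag multiplier Y)\<close>. In its derivative the
  variation of the multipliers contributes multiples of the rows of \<open>Y\<close>, and so does
  the outer projection; both are orthogonal to the tangent vector \<open>V\<close>. What survives is
  \<open>-2 <S(Y), V V^T>\<close>.\<close>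

lemma riemannian_hess_inner:
  assumes Y: "Y \<in> carrier_mat n r" and V: "V \<in> carrier_mat n r"
    and tangent: "\<And>i. i < n \<Longrightarrow> (\<Sum>l<r. V $$ (i, l) * Y $$ (i, l)) = 0"
  shows "mat_inner V (riemannian_hess f Y V) =
    2 * (\<Sum>i<n. \<Sum>j<n. c i j * (\<Sum>l<r. V $$ (i, l) * V $$ (j, l)))
    - 2 * (\<Sum>i<n. multiplier n r c (\<lambda>i l. Y $$ (i, l)) i * (\<Sum>l<r. (V $$ (i, l))\<^sup>2))"
proof -
  let ?m = "multiplier n r c (\<lambda>i l. Y $$ (i, l))"
  \<comment> \<open>The derivative along \<open>V\<close> of twice the multiplier of row
    \<open>i\<close>.\<close>
  define w where "w i = (\<Sum>k<r. 2 * (\<Sum>b<n. c i b * V $$ (b, k)) * Y $$ (i, k)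
    + 2 * (\<Sum>b<n. c i b * Y $$ (b, k)) * V $$ (i, k))" for i
  define D where "D i l = 2 * (\<Sum>b<n. c i b * V $$ (b, l)) - w i * Y $$ (i, l) - 2 * ?m i * V $$ (i, l)"
    for i l
  have deriv: "deriv (\<lambda>t. riemannian_grad f (Y + t \<cdot>\<^sub>m V) $$ (i, l)) 0 = D i l"
    if "i < n" "l < r" for i l
  proof (rule DERIV_imp_deriv)
    let ?y = "\<lambda>t a k. Y $$ (a, k) + t * V $$ (a, k)"
    have eq: "riemannian_grad f (Y + t \<cdot>\<^sub>m V) $$ (i, l) = 2 * (\<Sum>b<n. c i b * ?y t b l)
        - (\<Sum>k<r. 2 * (\<Sum>b<n. c i b * ?y t b k) * ?y t i k) * ?y t i l" for t
      using Y V that by (subst riemannian_grad_entry) auto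
    show "((\<lambda>t. riemannian_grad f (Y + t \<cdot>\<^sub>m V) $$ (i, l)) has_real_derivative D i l) (at 0)"
      unfolding eq D_def w_def multiplier_eq[symmetric]
      by (auto intro!: derivative_eq_intros sum.cong simp: algebra_simps sum.distrib)
  qed
  let ?H = "Matrix.mat n r (\<lambda>(i, l). D i l)"
  have "Matrix.mat (dim_row Y) (dim_col Y)
      (\<lambda>(i, j). deriv (\<lambda>t. riemannian_grad f (Y + t \<cdot>\<^sub>m V) $$ (i, j)) 0) = ?H"
    using Y deriv by (intro eq_matI) auto
  then have hess: "riemannian_hess f Y V = tangent_proj Y ?H"
    by (simp add: riemannian_hess_def)
  have H: "?H \<in> carrier_mat n r" by auto
  have row: "(\<Sum>l<r. V $$ (i, l) * tangent_proj Y ?H $$ (i, l)) =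
      2 * (\<Sum>l<r. V $$ (i, l) * (\<Sum>b<n. c i b * V $$ (b, l))) - 2 * (?m i * (\<Sum>l<r. (V $$ (i, l))\<^sup>2))"
    if "i < n" for i
  proof -
    let ?s = "w i + (\<Sum>k<r. D i k * Y $$ (i, k))"
    have "(\<Sum>l<r. V $$ (i, l) * tangent_proj Y ?H $$ (i, l)) =
       (\<Sum>l<r. 2 * (V $$ (i, l) * (\<Sum>b<n. c i b * V $$ (b, l))) - 2 * (?m i * (V $$ (i, l))\<^sup>2)
          - ?s * (V $$ (i, l) * Y $$ (i, l)))"
    proof (rule sum.cong)
      fix l assume "l \<in> {..<r}"
      then have "tangent_proj Y ?H $$ (i, l) = D i l - (\<Sum>k<r. D i k * Y $$ (i, k)) * Y $$ (i, l)"
        using that by (simp add: tangent_proj_entry[OF Y H] row_proj_def)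
      then have "tangent_proj Y ?H $$ (i, l) = 2 * (\<Sum>b<n. c i b * V $$ (b, l))
          - ?s * Y $$ (i, l) - 2 * ?m i * V $$ (i, l)"
        by (simp add: D_def distrib_right)
      then show "V $$ (i, l) * tangent_proj Y ?H $$ (i, l) =
          2 * (V $$ (i, l) * (\<Sum>b<n. c i b * V $$ (b, l))) - 2 * (?m i * (V $$ (i, l))\<^sup>2)
          - ?s * (V $$ (i, l) * Y $$ (i, l))"
        by (simp add: right_diff_distrib power2_eq_square mult_ac)
    qed simp
    then show ?thesis
      by (simp add: sum_subtractf tangent[OF that] flip: sum_distrib_left)
  qed
  have "mat_inner V (riemannian_hess f Y V) = (\<Sum>i<n. \<Sum>l<r. V $$ (i, l) * tangent_proj Y ?H $$ (i, l))"
    unfolding hess by (rule mat_inner_sum[OF V tangent_proj_carrier[OF Y H]])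
  also have "\<dots> = 2 * (\<Sum>i<n. \<Sum>l<r. V $$ (i, l) * (\<Sum>b<n. c i b * V $$ (b, l)))
      - 2 * (\<Sum>i<n. ?m i * (\<Sum>l<r. (V $$ (i, l))\<^sup>2))"
    by (simp add: row sum_subtractf flip: sum_distrib_left)
  also have "(\<Sum>i<n. \<Sum>l<r. V $$ (i, l) * (\<Sum>b<n. c i b * V $$ (b, l)))
      = (\<Sum>i<n. \<Sum>j<n. c i j * (\<Sum>l<r. V $$ (i, l) * V $$ (j, l)))"
    by (simp add: sum_distrib_left sum.swap[of _ "{..<r}"] mult_ac)
  finally show ?thesis .
qed

text \<open>For unit rows the tangent vectors are exactly the row-wise projections: a projection is
  orthogonal to its row, and a tangent vector is its own projection.\<close>

lemma second_order_critical_iff: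
  "second_order_critical n r f Y \<longleftrightarrow> Y \<in> carrier_mat n r \<and> soc n r c (\<lambda>i l. Y $$ (i, l))"
proof (cases "Y \<in> sphere_product n r")
  case False
  then show ?thesis by (auto simp: second_order_critical_def soc_def sphere_product_iff)
next
  case True
  then have Y: "Y \<in> carrier_mat n r" and unit: "\<And>i. i < n \<Longrightarrow> (\<Sum>l<r. (Y $$ (i, l))\<^sup>2) = 1"
    by (auto simp: sphere_product_iff)
  let ?y = "\<lambda>i l. Y $$ (i, l)"
  let ?Q = "\<lambda>V. (\<Sum>i<n. \<Sum>j<n. c i j * (\<Sum>l<r. V i l * V j l))
      \<le> (\<Sum>i<n. multiplier n r c ?y i * (\<Sum>l<r. (V i l)\<^sup>2))"
  have "(\<forall>V \<in> tangent_space Y. mat_inner V (riemannian_hess f Y V) \<le> 0) \<longleftrightarrow> (\<forall>Z. ?Q (row_proj r ?y Z))"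
  proof safe
    fix Z assume *: "\<forall>V \<in> tangent_space Y. mat_inner V (riemannian_hess f Y V) \<le> 0"
    let ?V = "Matrix.mat n r (\<lambda>(i, l). row_proj r ?y Z i l)"
    have V: "?V \<in> carrier_mat n r" by auto
    have t: "(\<Sum>l<r. ?V $$ (i, l) * Y $$ (i, l)) = 0" if "i < n" for i
    proof -
      have "(\<Sum>l<r. ?V $$ (i, l) * Y $$ (i, l))
         = (\<Sum>l<r. Z i l * Y $$ (i, l)) - (\<Sum>k<r. Z i k * Y $$ (i, k)) * (\<Sum>l<r. (Y $$ (i, l))\<^sup>2)"
        using that by (simp add: row_proj_def left_diff_distrib sum_subtractf sum_distrib_left
            power2_eq_square mult.assoc)
      then show ?thesis by (simp add: unit[OF that])
    qed
    then have "?V \<in> tangent_space Y" using V by (simp add: tangent_space_iff[OF Y])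
    with * have "mat_inner ?V (riemannian_hess f Y ?V) \<le> 0" by blast
    then show "?Q (row_proj r ?y Z)"
      using riemannian_hess_inner[OF Y V t] by simp
  next
    fix V assume *: "\<forall>Z. ?Q (row_proj r ?y Z)" and "V \<in> tangent_space Y"
    then have V: "V \<in> carrier_mat n r" and t: "\<And>i. i < n \<Longrightarrow> (\<Sum>l<r. V $$ (i, l) * Y $$ (i, l)) = 0"
      by (auto simp: tangent_space_iff[OF Y])
    have "row_proj r ?y (\<lambda>i l. V $$ (i, l)) i l = V $$ (i, l)" if "i < n" for i l
      by (simp add: row_proj_def t[OF that])
    then have "?Q (\<lambda>i l. V $$ (i, l))"
      using *[rule_format, of "\<lambda>i l. V $$ (i, l)"] by simp
    then show "mat_inner V (riemannian_hess f Y V) \<le> 0"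
      using riemannian_hess_inner[OF Y V t] by simp
  qed
  then show ?thesis
    using True Y unit by (simp add: second_order_critical_def soc_def riemannian_grad_eq_0_iff)
qed

end

section \<open>Measurability\<close>

text \<open>Projection along a compact factor is a closed map; \<open>F\<close> is first cut down to
  \<open>UNIV \<times> K\<close>.\<close>

lemma closed_projection_compact:
  fixes F :: "('a::topological_space \<times> 'b::topological_space) set"
  assumes "compact K" "closed F"
  shows "closed {x. \<exists>y\<in>K. (x, y) \<in> F}"
proof -
  have "compact_space (top_of_set K)"
    using \<open>compact K\<close> by (simp add: compact_space_subtopology)
  then have "closed_map (prod_topology (euclidean :: 'a topology) (top_of_set K)) euclidean fst"
    by (rule Abstract_Topological_Spaces.closed_map_fst)
  moreover have "prod_topology (euclidean :: 'a topology) (top_of_set K) = top_of_set (UNIV \<times> K)"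
    using subtopology_Times[of euclidean euclidean "UNIV :: 'a set" K] by simp
  moreover have "closedin (top_of_set (UNIV \<times> K)) (F \<inter> (UNIV \<times> K))"
    using \<open>closed F\<close> by (auto simp: closedin_closed)
  ultimately have "closed (fst ` (F \<inter> (UNIV \<times> K)))"
    by (auto simp: closed_map_def simp flip: closed_closedin)
  moreover have "fst ` (F \<inter> (UNIV \<times> K)) = {x. \<exists>y\<in>K. (x, y) \<in> F}"
    by force
  ultimately show ?thesis by simp
qed

text \<open>Tychonoff's theorem. With functions on all index pairs, one product space serves every
  \<open>r\<close>.\<close>

lemma compact_cube: "compact {y :: 'a \<Rightarrow> real. \<forall>p. y p \<in> {-1..1}}"
proof -
  have "compactin (product_topology (\<lambda>_. euclidean) UNIV) (PiE (UNIV :: 'a set) (\<lambda>_. {-1..1::real}))"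
    by (simp add: compactin_PiE)
  moreover have "PiE (UNIV :: 'a set) (\<lambda>_. {-1..1::real}) = {y. \<forall>p. y p \<in> {-1..1}}"
    by auto
  ultimately show ?thesis by (simp add: euclidean_product_topology)
qed

text \<open>Only entries with indices in range matter, which allows passing between matrices and
  functions padded by zero.\<close>

lemma soc_cong:
  assumes "\<And>i j. i < n \<Longrightarrow> j < n \<Longrightarrow> C i j = C' i j" "\<And>i l. i < n \<Longrightarrow> l < r \<Longrightarrow> Y i l = Y' i l"
  shows "soc n r C Y \<longleftrightarrow> soc n r C' Y'"
proof -
  have "multiplier n r C Y i = multiplier n r C' Y' i" if "i < n" for i
    using assms that by (simp add: multiplier_def)
  moreover have "row_proj r Y Z i l = row_proj r Y' Z i l" if "i < n" "l < r" for Z i l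
    using assms that by (simp add: row_proj_def)
  ultimately show ?thesis using assms by (simp add: soc_def)
qed

lemma closed_soc:
  "closed {(c :: nat \<times> nat \<Rightarrow> real, y :: nat \<times> nat \<Rightarrow> real).
     soc n r (curry c) (curry y) \<and> \<delta> \<le> (\<Sum>i<n. \<Sum>j<n. \<bar>(\<Sum>l<r. y (i, l) * y (j, l)) - G i j\<bar>)}"
proof -
  have [continuous_intros]: "continuous_on UNIV (\<lambda>x :: (nat \<times> nat \<Rightarrow> real) \<times> (nat \<times> nat \<Rightarrow> real). fst x p)"
    "continuous_on UNIV (\<lambda>x :: (nat \<times> nat \<Rightarrow> real) \<times> (nat \<times> nat \<Rightarrow> real). snd x p)" for p
    by (rule continuous_on_product_then_coordinatewise, intro continuous_intros)+
  show ?thesis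
    unfolding soc_def multiplier_def row_proj_def curry_def case_prod_beta
    by (intro closed_Collect_conj closed_Collect_all closed_Collect_imp open_Collect_const
        closed_Collect_eq closed_Collect_le continuous_intros)
qed

text \<open>
  Measurability has to be proved since \<^const>\<open>measure\<close> is 0 outside \<^term>\<open>sets M\<close>. For fixed \<open>r\<close> the
  matrices with a spurious critical point at distance at least \<open>1 / (k + 1)\<close> form the projection of
  a closed set along the compact cube, hence a closed set.
\<close>

lemma sets_benign:
  fixes C :: "'a \<Rightarrow> real mat" and z :: "real Matrix.vec"
  assumes C: "\<And>\<omega>. \<omega> \<in> space M \<Longrightarrow> C \<omega> \<in> carrier_mat n n"
    and C_sym: "\<And>\<omega>. \<omega> \<in> space M \<Longrightarrow> transpose_mat (C \<omega>) = C \<omega>"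
    and meas: "\<And>i j. i < n \<Longrightarrow> j < n \<Longrightarrow> (\<lambda>\<omega>. C \<omega> $$ (i, j)) \<in> borel_measurable M"
    and z: "z \<in> carrier_vec n"
  shows "{\<omega> \<in> space M. \<forall>r \<ge> (2::nat). \<forall>Y. second_order_critical n r (\<lambda>X. mat_inner (C \<omega>) (X * transpose_mat X)) Y
      \<longrightarrow> Y * transpose_mat Y = outer z} \<in> sets M"
proof -
  define c where "c \<omega> = (\<lambda>(i, j). if i < n \<and> j < n then C \<omega> $$ (i, j) else 0)" for \<omega>
  define K where "K = {y :: nat \<times> nat \<Rightarrow> real. \<forall>p. y p \<in> {-1..1}}"
  \<comment> \<open>The entrywise l1 distance between the Gram matrix of the rows and
    \<open>outer z\<close>; it vanishes exactly when the two agree.\<close>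
  define g where "g r y = (\<Sum>i<n. \<Sum>j<n. \<bar>(\<Sum>l<r. y (i, l) * y (j, l)) - vec_index z i * vec_index z j\<bar>)"
    for r and y :: "nat \<times> nat \<Rightarrow> real"
  define B where "B r k = {c. \<exists>y\<in>K. (c, y) \<in> {(c, y). soc n r (curry c) (curry y) \<and> 1 / real (Suc k) \<le> g r y}}"
    for r k
  have "closed (B r k)" for r k
    unfolding B_def g_def K_def by (intro closed_projection_compact compact_cube closed_soc)
  then have [measurable]: "B r k \<in> sets borel" for r k by (rule borel_closed)
  have [measurable]: "c \<in> borel_measurable M"
  proof (rule measurable_coordinatewise_then_product)
    fix p :: "nat \<times> nat"
    show "(\<lambda>\<omega>. c \<omega> p) \<in> borel_measurable M"
      using meas[of "fst p" "snd p"]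
      by (cases p; cases "fst p < n \<and> snd p < n") (auto simp: c_def)
  qed
  have "(\<forall>Y. second_order_critical n r (\<lambda>X. mat_inner (C \<omega>) (X * transpose_mat X)) Y
      \<longrightarrow> Y * transpose_mat Y = outer z) \<longleftrightarrow> (\<forall>k. c \<omega> \<notin> B r k)" if \<omega>: "\<omega> \<in> space M" for r \<omega>
  proof -
    note crit = second_order_critical_iff[OF C[OF \<omega>] C_sym[OF \<omega>]]
    have outer: "Y * transpose_mat Y = outer z \<longleftrightarrow> g r (\<lambda>(i, l). Y $$ (i, l)) = 0"
      if "Y \<in> carrier_mat n r" for Y
    proof -
      have "Y * transpose_mat Y = outer z \<longleftrightarrow>
        (\<forall>i<n. \<forall>j<n. (Y * transpose_mat Y) $$ (i, j) = vec_index z i * vec_index z j)"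
        using that z by (auto simp: outer_def mat_eq_iff)
      also have "\<dots> \<longleftrightarrow> (\<forall>i<n. \<forall>j<n. (\<Sum>l<r. Y $$ (i, l) * Y $$ (j, l)) = vec_index z i * vec_index z j)"
        using mult_transpose_entry[OF that that] by simp
      also have "\<dots> \<longleftrightarrow> g r (\<lambda>(i, l). Y $$ (i, l)) = 0"
        by (auto simp: g_def sum_nonneg_eq_0_iff sum_nonneg)
      finally show ?thesis .
    qed
    have g_cong: "g r y = g r y'" if "\<And>i l. i < n \<Longrightarrow> l < r \<Longrightarrow> y (i, l) = y' (i, l)" for y y'
      using that by (simp add: g_def)
    have g_nonneg: "0 \<le> g r y" for y by (simp add: g_def sum_nonneg)
    have soc_c: "soc n r (curry (c \<omega>)) Y \<longleftrightarrow> soc n r (\<lambda>i j. C \<omega> $$ (i, j)) Y" for Y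
      by (rule soc_cong) (auto simp: c_def)
    show ?thesis
    proof safe
      fix k assume *: "\<forall>Y. second_order_critical n r (\<lambda>X. mat_inner (C \<omega>) (X * transpose_mat X)) Y
        \<longrightarrow> Y * transpose_mat Y = outer z" and "c \<omega> \<in> B r k"
      then obtain y where y: "soc n r (curry (c \<omega>)) (curry y)" "1 / real (Suc k) \<le> g r y"
        by (auto simp: B_def)
      define Y where "Y = Matrix.mat n r y"
      have "soc n r (\<lambda>i j. C \<omega> $$ (i, j)) (\<lambda>i l. Y $$ (i, l))"
        using y(1) unfolding soc_c by (subst soc_cong[where Y'="curry y"]) (auto simp: Y_def)
      then have "Y * transpose_mat Y = outer z"
        using * crit[of r Y] by (simp add: Y_def)
      then have "g r (\<lambda>(i, l). Y $$ (i, l)) = 0" using outer by (simp add: Y_def)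
      then have "g r y = 0" by (subst (asm) g_cong[where y'=y]) (auto simp: Y_def)
      with y(2) show False by (simp add: divide_le_0_iff)
    next
      fix Y assume *: "\<forall>k. c \<omega> \<notin> B r k"
        and "second_order_critical n r (\<lambda>X. mat_inner (C \<omega>) (X * transpose_mat X)) Y"
      then have Y: "Y \<in> carrier_mat n r" and soc: "soc n r (\<lambda>i j. C \<omega> $$ (i, j)) (\<lambda>i l. Y $$ (i, l))"
        using crit by auto
      define y where "y = (\<lambda>(i, l). if i < n \<and> l < r then Y $$ (i, l) else 0)"
      have "soc n r (curry (c \<omega>)) (curry y)"
        using soc unfolding soc_c by (subst soc_cong[where Y'="\<lambda>i l. Y $$ (i, l)"]) (auto simp: y_def)
      moreover have "y \<in> K"
      proof -
        have "\<bar>Y $$ (i, l)\<bar> \<le> 1" if "i < n" "l < r" for i l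
        proof -
          have "(Y $$ (i, l))\<^sup>2 \<le> (\<Sum>l<r. (Y $$ (i, l))\<^sup>2)"
            using that by (intro member_le_sum) auto
          also have "\<dots> = 1" using soc that by (simp add: soc_def)
          finally show ?thesis by (simp add: abs_square_le_1)
        qed
        then show ?thesis by (auto simp: K_def y_def abs_le_iff minus_le_iff)
      qed
      ultimately have "\<not> 1 / real (Suc k) \<le> g r y" for k
        using * by (auto simp: B_def)
      then have "g r y \<le> 0"
        by (meson nat_approx_posE not_le less_imp_le)
      then have "g r y = 0" using g_nonneg[of y] by simp
      then have "g r (\<lambda>(i, l). Y $$ (i, l)) = 0"
        by (subst (asm) g_cong[where y'="\<lambda>(i, l). Y $$ (i, l)"]) (auto simp: y_def)
      then show "Y * transpose_mat Y = outer z" using outer[OF Y] by simp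
    qed
  qed
  then have "{\<omega> \<in> space M. \<forall>r \<ge> (2::nat). \<forall>Y. second_order_critical n r (\<lambda>X. mat_inner (C \<omega>) (X * transpose_mat X)) Y
      \<longrightarrow> Y * transpose_mat Y = outer z} = {\<omega> \<in> space M. \<forall>r \<ge> (2::nat). \<forall>k. c \<omega> \<notin> B r k}"
    by blast
  \<comment> \<open>The quantifiers over \<open>r\<close> and \<open>k\<close> are countable; the
    uncountable one over \<open>Y\<close> is hidden in the closed sets \<open>B r k\<close>.\<close>
  also have "\<dots> \<in> sets M" by measurable
  finally show ?thesis .
qed

section \<open>Gaussian tails and the operator norm\<close>

text \<open>Completing the square leaves \<open>exp (s^2 / 2)\<close> times the normal density with
  mean \<open>s\<close>.\<close>

lemma (in prob_space) nn_integral_exp_std_normal: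
  assumes "distributed M lborel X std_normal_density"
  shows "(\<integral>\<^sup>+\<omega>. ennreal (exp (s * X \<omega>)) \<partial>M) = ennreal (exp (s\<^sup>2 / 2))"
proof -
  have "(\<integral>\<^sup>+\<omega>. ennreal (exp (s * X \<omega>)) \<partial>M)
      = (\<integral>\<^sup>+x. ennreal (std_normal_density x) * ennreal (exp (s * x)) \<partial>lborel)"
    by (rule distributed_nn_integral[OF assms, symmetric]) simp
  also have "\<dots> = (\<integral>\<^sup>+x. ennreal (exp (s\<^sup>2 / 2)) * ennreal (normal_density s 1 x) \<partial>lborel)"
  proof (rule nn_integral_cong)
    fix x
    have "- x\<^sup>2 / 2 + s * x = s\<^sup>2 / 2 + - (x - s)\<^sup>2 / 2"
      by (simp add: power2_eq_square field_simps)
    then have "exp (- x\<^sup>2 / 2) * exp (s * x) = exp (s\<^sup>2 / 2) * exp (- (x - s)\<^sup>2 / 2)"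
      by (metis exp_add)
    then have "std_normal_density x * exp (s * x) = exp (s\<^sup>2 / 2) * normal_density s 1 x"
      by (simp add: normal_density_def mult_ac)
    then show "ennreal (std_normal_density x) * ennreal (exp (s * x))
        = ennreal (exp (s\<^sup>2 / 2)) * ennreal (normal_density s 1 x)"
      by (simp flip: ennreal_mult)
  qed
  also have "\<dots> = ennreal (exp (s\<^sup>2 / 2)) * (\<integral>\<^sup>+x. ennreal (normal_density s 1 x) \<partial>lborel)"
    by (rule nn_integral_cmult) simp
  also have "(\<integral>\<^sup>+x. ennreal (normal_density s 1 x) \<partial>lborel) = 1"
    by (subst nn_integral_eq_integral) auto
  finally show ?thesis by simp
qed

text \<open>Chernoff bound: the indicator of the event is dominated by an exponential, whose
  expectation factorizes by independence.\<close>

lemma (in prob_space) std_normal_combination_tail: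
  fixes X :: "'i \<Rightarrow> 'a \<Rightarrow> real" and a :: "'i \<Rightarrow> real"
  assumes "finite I" and indep: "indep_vars (\<lambda>_. borel) X I"
    and X: "\<And>k. k \<in> I \<Longrightarrow> distributed M lborel (X k) std_normal_density"
    and v: "(\<Sum>k\<in>I. (a k)\<^sup>2) \<le> v" "v > 0" and "t \<ge> 0"
  shows "prob {\<omega> \<in> space M. t \<le> (\<Sum>k\<in>I. a k * X k \<omega>)} \<le> exp (- t\<^sup>2 / (2 * v))"
proof -
  have [measurable]: "X k \<in> borel_measurable M" if "k \<in> I" for k
    using indep that by (simp add: indep_vars_def)
  \<comment> \<open>The minimizer of \<open>- \<theta> t + \<theta>^2 v / 2\<close>, with minimum
    \<open>- t^2 / (2 v)\<close>.\<close>
  define \<theta> where "\<theta> = t / v"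
  have "\<theta> \<ge> 0" using v \<open>t \<ge> 0\<close> by (simp add: \<theta>_def)
  let ?S = "\<lambda>\<omega>. \<Sum>k\<in>I. a k * X k \<omega>"
  let ?A = "{\<omega> \<in> space M. t \<le> ?S \<omega>}"
  have "emeasure M ?A = (\<integral>\<^sup>+\<omega>. indicator ?A \<omega> \<partial>M)"
    by (rule nn_integral_indicator[symmetric]) measurable
  also have "\<dots> \<le> (\<integral>\<^sup>+\<omega>. ennreal (exp (- \<theta> * t)) * (\<Prod>k\<in>I. ennreal (exp (\<theta> * a k * X k \<omega>))) \<partial>M)"
  proof (rule nn_integral_mono)
    fix \<omega>
    have "(\<Prod>k\<in>I. ennreal (exp (\<theta> * a k * X k \<omega>))) = ennreal (exp (\<theta> * ?S \<omega>))"
      by (simp add: prod_ennreal exp_sum \<open>finite I\<close> sum_distrib_left mult.assoc)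
    then have "ennreal (exp (- \<theta> * t)) * (\<Prod>k\<in>I. ennreal (exp (\<theta> * a k * X k \<omega>)))
        = ennreal (exp (\<theta> * (?S \<omega> - t)))"
      by (simp add: exp_add[symmetric] right_diff_distrib exp_diff exp_minus field_simps flip: ennreal_mult)
    moreover have "1 \<le> exp (\<theta> * (?S \<omega> - t))" if "t \<le> ?S \<omega>"
      using that \<open>\<theta> \<ge> 0\<close> by simp
    ultimately show "indicator ?A \<omega> \<le> ennreal (exp (- \<theta> * t)) * (\<Prod>k\<in>I. ennreal (exp (\<theta> * a k * X k \<omega>)))"
      by (auto simp: indicator_def)
  qed
  also have "\<dots> = ennreal (exp (- \<theta> * t)) * (\<integral>\<^sup>+\<omega>. (\<Prod>k\<in>I. ennreal (exp (\<theta> * a k * X k \<omega>))) \<partial>M)"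
    by (rule nn_integral_cmult) measurable
  also have "(\<integral>\<^sup>+\<omega>. (\<Prod>k\<in>I. ennreal (exp (\<theta> * a k * X k \<omega>))) \<partial>M)
      = (\<Prod>k\<in>I. \<integral>\<^sup>+\<omega>. ennreal (exp (\<theta> * a k * X k \<omega>)) \<partial>M)"
    using \<open>finite I\<close> indep_vars_compose2[OF indep, where Y="\<lambda>k x. ennreal (exp (\<theta> * a k * x))"]
    by (intro indep_vars_nn_integral) auto
  also have "\<dots> = (\<Prod>k\<in>I. ennreal (exp ((\<theta> * a k)\<^sup>2 / 2)))"
    by (intro prod.cong refl nn_integral_exp_std_normal X)
  also have "\<dots> = ennreal (exp (\<theta>\<^sup>2 / 2 * (\<Sum>k\<in>I. (a k)\<^sup>2)))"
    by (simp add: prod_ennreal exp_sum \<open>finite I\<close> sum_distrib_left power_mult_distrib)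
  also have "ennreal (exp (- \<theta> * t)) * \<dots> = ennreal (exp (- \<theta> * t + \<theta>\<^sup>2 / 2 * (\<Sum>k\<in>I. (a k)\<^sup>2)))"
    by (simp only: exp_add ennreal_mult exp_ge_zero)
  also have "\<dots> \<le> ennreal (exp (- \<theta> * t + \<theta>\<^sup>2 / 2 * v))"
    using v by (intro ennreal_leI) (simp add: mult_left_mono)
  also have "- \<theta> * t + \<theta>\<^sup>2 / 2 * v = - t\<^sup>2 / (2 * v)"
    using v by (simp add: \<theta>_def power2_eq_square field_simps)
  finally show ?thesis
    by (simp add: measure_def enn2real_leI)
qed

text \<open>Independence covers only the entries on and above the diagonal, so a sum over all
  entries is first folded onto these pairs.\<close>

lemma sum_pairs_fold:
  fixes A :: "nat \<Rightarrow> nat \<Rightarrow> real"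
  shows "(\<Sum>i<n. \<Sum>j<n. A i j) =
    (\<Sum>(i, j)\<in>{(i, j). i \<le> j \<and> j < n}. if i = j then A i i else A i j + A j i)"
proof -
  let ?I = "{(i, j). i \<le> j \<and> j < n}" and ?J = "{(i, j). j < i \<and> i < n}"
  have fin: "finite ?I" "finite ?J"
    by (auto intro: finite_subset[of _ "{..<n} \<times> {..<n}"])
  have "(\<Sum>i<n. \<Sum>j<n. A i j) = (\<Sum>(i, j)\<in>{..<n} \<times> {..<n}. A i j)"
    by (rule sum.cartesian_product)
  also have "{..<n} \<times> {..<n} = ?I \<union> ?J" by auto
  also have "(\<Sum>(i, j)\<in>?I \<union> ?J. A i j) = (\<Sum>(i, j)\<in>?I. A i j) + (\<Sum>(i, j)\<in>?J. A i j)"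
    using fin by (intro sum.union_disjoint) auto
  also have "(\<Sum>(i, j)\<in>?J. A i j) = (\<Sum>p\<in>{p\<in>?I. fst p \<noteq> snd p}. A (snd p) (fst p))"
    by (rule sum.reindex_bij_witness[where i="prod.swap" and j="prod.swap"]) auto
  also have "\<dots> = (\<Sum>p\<in>?I. if fst p \<noteq> snd p then A (snd p) (fst p) else 0)"
    by (rule sum.inter_filter[OF fin(1)])
  finally show ?thesis
    by (simp only: sum.distrib[symmetric]) (auto intro!: sum.cong)
qed

section \<open>Operator norm from a lattice net\<close>

definition qf :: "nat \<Rightarrow> (nat \<Rightarrow> nat \<Rightarrow> real) \<Rightarrow> (nat \<Rightarrow> real) \<Rightarrow> real" where
  "qf n w x = (\<Sum>i<n. \<Sum>j<n. x i * x j * w i j)"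

lemma qf_scale: "qf n w (\<lambda>i. c * x i) = c\<^sup>2 * qf n w x"
  by (simp add: qf_def sum_distrib_left power2_eq_square mult_ac)

text \<open>The supremum \<open>s\<close> of the form over the unit ball satisfies \<open>s \<le> 12 \<surd>n + s / 2\<close>: rounding
  \<open>4 \<surd>n x\<close> towards zero moves \<open>x\<close> by at most \<open>1/4\<close> within the ball.\<close>

lemma qf_bound_of_lattice_bound:
  assumes "n \<ge> 1"
    and lattice: "\<And>k :: nat \<Rightarrow> int. (\<Sum>i<n. (k i)\<^sup>2) \<le> 16 * int n \<Longrightarrow>
      \<bar>qf n w (\<lambda>i. of_int (k i))\<bar> \<le> 192 * real n * sqrt n"
  shows "\<bar>qf n w x\<bar> \<le> 24 * sqrt n * (\<Sum>i<n. (x i)\<^sup>2)"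
proof -
  let ?N = "\<lambda>x. \<Sum>i<n. (x i)\<^sup>2"
  define s where "s = (SUP x\<in>{x. ?N x \<le> 1}. \<bar>qf n w x\<bar>)"
  have "\<bar>qf n w x\<bar> \<le> (\<Sum>i<n. \<Sum>j<n. \<bar>w i j\<bar>)" if "?N x \<le> 1" for x
  proof -
    have 1: "\<bar>x i\<bar> \<le> 1" if "i < n" for i
    proof -
      have "(x i)\<^sup>2 \<le> ?N x" using that by (intro member_le_sum) auto
      with \<open>?N x \<le> 1\<close> have "(x i)\<^sup>2 \<le> 1" by linarith
      then show ?thesis by (simp add: abs_square_le_1)
    qed
    have "\<bar>x i * x j * w i j\<bar> \<le> \<bar>w i j\<bar>" if "i < n" "j < n" for i j
      using mult_mono[OF 1[OF that(1)] 1[OF that(2)]]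
      by (simp add: abs_mult mult_left_le_one_le)
    then have "\<bar>x i * x j * w i j\<bar> \<le> \<bar>w i j\<bar>" if "i \<in> {..<n}" "j \<in> {..<n}" for i j
      using that by simp
    then show ?thesis
      unfolding qf_def by (intro order_trans[OF sum_abs] sum_mono) blast
  qed
  then have bdd: "bdd_above ((\<lambda>x. \<bar>qf n w x\<bar>) ` {x. ?N x \<le> 1})" by (intro bdd_aboveI2) auto
  have le_s: "\<bar>qf n w x\<bar> \<le> s" if "?N x \<le> 1" for x
    unfolding s_def using that by (intro cSUP_upper[OF _ bdd]) auto
  have hom: "\<bar>qf n w x\<bar> \<le> s * ?N x" for x
  proof (cases "?N x = 0")
    case True
    then have "x i = 0" if "i < n" for i using that by (simp add: sum_nonneg_eq_0_iff)
    then show ?thesis by (simp add: qf_def)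
  next
    case False
    then have pos: "?N x > 0" by (simp add: order.not_eq_order_implies_strict sum_nonneg)
    define c where "c = 1 / sqrt (?N x)"
    have c: "c\<^sup>2 = 1 / ?N x" using pos by (simp add: c_def power_divide)
    have "?N (\<lambda>i. c * x i) = 1"
      using False by (simp add: power_mult_distrib c flip: sum_divide_distrib)
    then have "\<bar>qf n w (\<lambda>i. c * x i)\<bar> \<le> s" by (intro le_s) simp
    then show ?thesis using pos by (simp add: qf_scale c field_simps abs_mult)
  qed
  have "\<bar>qf n w x\<bar> \<le> 12 * sqrt n + s / 2" if x: "?N x \<le> 1" for x
  proof -
    define R where "R = 4 * sqrt n"
    have R: "R > 0" "R\<^sup>2 = 16 * n" using \<open>n \<ge> 1\<close> by (auto simp: R_def power_mult_distrib)
    \<comment> \<open>Rounding towards zero gives \<open>|y i| \<le> |x i|\<close>, which keeps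
      \<open>y\<close> in the unit ball and hence \<open>k\<close> in the lattice ball.\<close>
    define k where "k i = (if x i \<ge> 0 then \<lfloor>R * x i\<rfloor> else \<lceil>R * x i\<rceil>)" for i
    define y where "y i = of_int (k i) / R" for i
    have k: "\<bar>of_int (k i)\<bar> \<le> R * \<bar>x i\<bar>" "\<bar>R * x i - of_int (k i)\<bar> \<le> 1" for i
    proof -
      have "R * x i \<ge> 0 \<longleftrightarrow> x i \<ge> 0" using R by (simp add: zero_le_mult_iff)
      then have "\<bar>of_int (k i)\<bar> \<le> \<bar>R * x i\<bar> \<and> \<bar>R * x i - of_int (k i)\<bar> \<le> 1"
        unfolding k_def by (cases "x i \<ge> 0") (simp; linarith)+
      then show "\<bar>of_int (k i)\<bar> \<le> R * \<bar>x i\<bar>" "\<bar>R * x i - of_int (k i)\<bar> \<le> 1"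
        using R by (auto simp: abs_mult)
    qed
    have y: "(y i)\<^sup>2 \<le> (x i)\<^sup>2" "(x i - y i)\<^sup>2 \<le> 1 / (16 * n)" for i
    proof -
      have "\<bar>y i\<bar> \<le> \<bar>x i\<bar>" using k(1)[of i] R by (simp add: y_def field_simps)
      then show "(y i)\<^sup>2 \<le> (x i)\<^sup>2" by (simp add: abs_le_square_iff)
      have "x i - y i = (R * x i - of_int (k i)) / R" using R by (simp add: y_def field_simps)
      moreover have "(R * x i - of_int (k i))\<^sup>2 \<le> 1" using k(2)[of i] by (simp add: abs_square_le_1)
      ultimately show "(x i - y i)\<^sup>2 \<le> 1 / (16 * n)"
        using R \<open>n \<ge> 1\<close> by (simp add: power_divide divide_right_mono)
    qed
    have "?N y \<le> ?N x" by (intro sum_mono y)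
    with x have Ny: "?N y \<le> 1" by linarith
    have "?N (\<lambda>i. x i - y i) \<le> (\<Sum>i<n. 1 / (16 * n))" by (intro sum_mono y)
    then have Nxy: "?N (\<lambda>i. x i - y i) \<le> 1/16" using \<open>n \<ge> 1\<close> by simp
    have "real_of_int (\<Sum>i<n. (k i)\<^sup>2) = (\<Sum>i<n. R\<^sup>2 * (y i)\<^sup>2)"
      using R by (simp add: y_def power_divide)
    also have "\<dots> \<le> 16 * n"
      using mult_left_mono[OF Ny, of "R\<^sup>2"] R by (simp flip: sum_distrib_left)
    finally have "(\<Sum>i<n. (k i)\<^sup>2) \<le> 16 * int n" by linarith
    from lattice[OF this] have "\<bar>qf n w (\<lambda>i. R * y i)\<bar> \<le> 192 * real n * sqrt n"
      using R by (simp add: y_def)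
    then have "16 * n * \<bar>qf n w y\<bar> \<le> 16 * n * (12 * sqrt n)"
      unfolding qf_scale using R by (simp add: abs_mult)
    then have qy: "\<bar>qf n w y\<bar> \<le> 12 * sqrt n" using \<open>n \<ge> 1\<close> by simp
    \<comment> \<open>Polarization with \<open>4 (x - y)\<close> and \<open>(x + y) / 2\<close>.
      Since \<open>|x - y| \<le> 1/4\<close>, this scaling gives both vectors norm at most 1, and
      the form changes by at most \<open>s / 2\<close> between \<open>x\<close> and
      \<open>y\<close>.\<close>
    let ?U = "\<lambda>i. 4 * (x i - y i) + (x i + y i) / 2" and ?V = "\<lambda>i. 4 * (x i - y i) - (x i + y i) / 2"
    have "8 * (x i * x j * w i j - y i * y j * w i j) = ?U i * ?U j * w i j - ?V i * ?V j * w i j" for i j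
      by (simp add: field_simps)
    then have "8 * (qf n w x - qf n w y) = qf n w ?U - qf n w ?V"
      unfolding qf_def sum_distrib_left sum_subtractf[symmetric] by simp
    moreover have "?N ?U + ?N ?V \<le> 4"
    proof -
      have "(?U i)\<^sup>2 + (?V i)\<^sup>2 = 32 * (x i - y i)\<^sup>2 + (x i + y i)\<^sup>2 / 2" for i
        by (simp add: power2_eq_square field_simps)
      moreover have "(x i + y i)\<^sup>2 / 2 \<le> (x i)\<^sup>2 + (y i)\<^sup>2" for i
        using zero_le_power2[of "x i - y i"] by (simp add: power2_eq_square field_simps)
      ultimately have "(?U i)\<^sup>2 + (?V i)\<^sup>2 \<le> 32 * (x i - y i)\<^sup>2 + ((x i)\<^sup>2 + (y i)\<^sup>2)" for i
        by (metis add_left_mono)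
      then have "(\<Sum>i<n. (?U i)\<^sup>2 + (?V i)\<^sup>2) \<le> (\<Sum>i<n. 32 * (x i - y i)\<^sup>2 + ((x i)\<^sup>2 + (y i)\<^sup>2))"
        by (intro sum_mono)
      then show ?thesis using Nxy x Ny by (simp add: sum.distrib flip: sum_distrib_left)
    qed
    moreover have "s \<ge> 0" using le_s[of "\<lambda>_. 0"] by (simp add: qf_def)
    ultimately have "\<bar>8 * (qf n w x - qf n w y)\<bar> \<le> s * 4"
      using hom[of ?U] hom[of ?V] mult_left_mono[of "?N ?U + ?N ?V" 4 s]
      by (simp add: distrib_left)
    then have "\<bar>qf n w x - qf n w y\<bar> \<le> s / 2"
      unfolding abs_mult by simp
    then show ?thesis using qy by linarith
  qed
  then have "(SUP x\<in>{x. ?N x \<le> 1}. \<bar>qf n w x\<bar>) \<le> 12 * sqrt n + s / 2"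
    by (intro cSUP_least) (auto intro: exI[of _ "\<lambda>_. 0"])
  then have "s \<le> 12 * sqrt n + s / 2" by (simp flip: s_def)
  then have "s \<le> 24 * sqrt n" by simp
  then show ?thesis
    using hom[of x] mult_right_mono[of s "24 * sqrt n" "?N x"] by (simp add: sum_nonneg)
qed

section \<open>Counting lattice points\<close>

lemma abs_le_square_int: "\<bar>j\<bar> \<le> j\<^sup>2" for j :: int
  using mult_right_mono[of 1 "\<bar>j\<bar>" "\<bar>j\<bar>"]
  by (cases "j = 0") (auto simp: power2_eq_square abs_mult_self_eq)

lemma sum_half_powers_le: "(\<Sum>j\<in>{- int R..int R}. (1/2::real) ^ nat \<bar>j\<bar>) \<le> 3"
proof -
  have "(\<Sum>j\<in>{- int R..int R}. (1/2::real) ^ nat \<bar>j\<bar>) = 3 - 2 * (1/2) ^ R"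
  proof (induction R)
    case (Suc R)
    have "{- int (Suc R)..int (Suc R)} = insert (- int (Suc R)) (insert (int (Suc R)) {- int R..int R})"
      by auto
    moreover have "nat (int R + 1) = Suc R" "nat (1 + int R) = Suc R" by auto
    ultimately show ?case using Suc by simp
  qed simp
  then show ?thesis by simp
qed

text \<open>The cube places the set inside a finite product, over which sums of products factorize.
  It is large enough to contain every integer point of squared norm at most
  \<open>16 n\<close>.\<close>

definition lattice_ball :: "nat \<Rightarrow> (nat \<Rightarrow> int) set" where
  "lattice_ball n = {k \<in> {..<n} \<rightarrow>\<^sub>E {- int (16 * n)..int (16 * n)}. (\<Sum>i<n. (k i)\<^sup>2) \<le> 16 * int n}"

lemma finite_lattice_ball: "finite (lattice_ball n)"
  by (rule finite_subset[of _ "{..<n} \<rightarrow>\<^sub>E {- int (16 * n)..int (16 * n)}"])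
    (auto simp: lattice_ball_def intro: finite_PiE)

text \<open>
  Each point of the ball contributes at least 1 to the sum of the \<open>2 ^ (16 n - |k|\<^sub>1)\<close> over the
  enclosing cube, and that sum factorizes.
\<close>

lemma card_lattice_ball: "real (card (lattice_ball n)) \<le> 2 ^ (18 * n)"
proof -
  let ?P = "{..<n} \<rightarrow>\<^sub>E {- int (16 * n)..int (16 * n)}"
  have fin: "finite ?P" by (intro finite_PiE) auto
  have "1 \<le> 2 ^ (16 * n) * (\<Prod>i<n. (1/2::real) ^ nat \<bar>k i\<bar>)" if "k \<in> lattice_ball n" for k
  proof -
    have "int (\<Sum>i<n. nat \<bar>k i\<bar>) = (\<Sum>i<n. \<bar>k i\<bar>)" by simp
    also have "\<dots> \<le> (\<Sum>i<n. (k i)\<^sup>2)" by (intro sum_mono abs_le_square_int)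
    also have "\<dots> \<le> int (16 * n)" using that by (simp add: lattice_ball_def)
    finally have "(\<Sum>i<n. nat \<bar>k i\<bar>) \<le> 16 * n" by linarith
    then have "(2::real) ^ (\<Sum>i<n. nat \<bar>k i\<bar>) \<le> 2 ^ (16 * n)" by (intro power_increasing) auto
    then have "1 \<le> 2 ^ (16 * n) * (1/2::real) ^ (\<Sum>i<n. nat \<bar>k i\<bar>)"
      by (simp add: power_one_over field_simps)
    moreover have "(\<Prod>i<n. (1/2::real) ^ nat \<bar>k i\<bar>) = (1/2) ^ (\<Sum>i<n. nat \<bar>k i\<bar>)"
      by (simp only: power_sum)
    ultimately show ?thesis by (simp only:)
  qed
  then have "real (card (lattice_ball n)) \<le> (\<Sum>k\<in>lattice_ball n. 2 ^ (16 * n) * (\<Prod>i<n. (1/2::real) ^ nat \<bar>k i\<bar>))"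
    using sum_mono[of "lattice_ball n" "\<lambda>_. 1::real"] by simp
  also have "\<dots> \<le> (\<Sum>k\<in>?P. 2 ^ (16 * n) * (\<Prod>i<n. (1/2::real) ^ nat \<bar>k i\<bar>))"
  proof (rule sum_mono2[OF fin])
    show "lattice_ball n \<subseteq> ?P" unfolding lattice_ball_def by blast
  qed (intro mult_nonneg_nonneg prod_nonneg; simp)
  also have "\<dots> = 2 ^ (16 * n) * (\<Prod>i<n. \<Sum>j\<in>{- int (16 * n)..int (16 * n)}. (1/2::real) ^ nat \<bar>j\<bar>)"
    by (subst prod_sum_PiE) (simp_all only: sum_distrib_left finite_lessThan finite_atLeastAtMost_int)
  \<comment> \<open>The bound 3 is relaxed to 4 to obtain a power of two:
    \<open>2 ^ (16 n) * 4 ^ n = 2 ^ (18 n)\<close>.\<close>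
  also have "\<dots> \<le> 2 ^ (16 * n) * (\<Prod>i<n. 4)"
  proof (rule mult_left_mono)
    let ?S = "\<Sum>j\<in>{- int (16 * n)..int (16 * n)}. (1/2::real) ^ nat \<bar>j\<bar>"
    have "0 \<le> ?S" by (rule sum_nonneg) simp
    moreover have "?S \<le> 4" using sum_half_powers_le[of "16 * n"] by linarith
    ultimately show "(\<Prod>i<n. ?S) \<le> (\<Prod>i<n. 4)" by (intro prod_mono) blast
  qed simp
  also have "\<dots> = 2 ^ (18 * n)"
    by (simp add: power_mult power_mult_distrib[symmetric])
  finally show ?thesis .
qed

text \<open>After folding, an off-diagonal entry of \<open>W\<close> has coefficient
  \<open>A i j + A j i\<close>, and \<open>\<kappa>\<close> is the price of squaring this sum. It is
  1 if one of the two always vanishes, as for a row sum, and 2 in general.\<close>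

lemma gaussian_form_tail:
  fixes A :: "nat \<Rightarrow> nat \<Rightarrow> real"
  assumes M: "prob_space M" and W: "gaussian_symmetric_matrix M n W"
    and cross: "\<And>i j. i < n \<Longrightarrow> j < n \<Longrightarrow> i \<noteq> j \<Longrightarrow> (A i j + A j i)\<^sup>2 \<le> \<kappa> * ((A i j)\<^sup>2 + (A j i)\<^sup>2)"
    and "\<kappa> \<ge> 1" and v: "\<kappa> * (\<Sum>i<n. \<Sum>j<n. (A i j)\<^sup>2) \<le> v" "v > 0" and "t \<ge> 0"
  shows "measure M {\<omega> \<in> space M. t \<le> (\<Sum>i<n. \<Sum>j<n. A i j * W \<omega> $$ (i, j))} \<le> exp (- t\<^sup>2 / (2 * v))"
proof -
  interpret prob_space M by (rule M)
  let ?I = "{(i, j). i \<le> j \<and> j < n}"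
  have fin: "finite ?I" by (auto intro: finite_subset[of _ "{..<n} \<times> {..<n}"])
  define a where "a = (\<lambda>(i, j). if i = j then A i i else A i j + A j i)"
  define X where "X = (\<lambda>(i, j) \<omega>. W \<omega> $$ (i, j))"
  have "(a p)\<^sup>2 \<le> (case p of (i, j) \<Rightarrow> if i = j then \<kappa> * (A i i)\<^sup>2 else \<kappa> * (A i j)\<^sup>2 + \<kappa> * (A j i)\<^sup>2)"
    if "p \<in> ?I" for p
  proof (cases p)
    case (Pair i j)
    show ?thesis
    proof (cases "i = j")
      case True
      then show ?thesis using Pair mult_right_mono[OF \<open>\<kappa> \<ge> 1\<close>, of "(A i i)\<^sup>2"] by (simp add: a_def)
    next
      case False
      then show ?thesis using Pair cross[of i j] that by (simp add: a_def distrib_left)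
    qed
  qed
  then have "(\<Sum>p\<in>?I. (a p)\<^sup>2) \<le>
      (\<Sum>(i, j)\<in>?I. if i = j then \<kappa> * (A i i)\<^sup>2 else \<kappa> * (A i j)\<^sup>2 + \<kappa> * (A j i)\<^sup>2)"
    by (rule sum_mono)
  also have "\<dots> = \<kappa> * (\<Sum>i<n. \<Sum>j<n. (A i j)\<^sup>2)"
    by (simp add: sum_distrib_left sum_pairs_fold[where A="\<lambda>i j. \<kappa> * (A i j)\<^sup>2"])
  finally have le_v: "(\<Sum>p\<in>?I. (a p)\<^sup>2) \<le> v" using v by linarith
  have "(\<Sum>i<n. \<Sum>j<n. A i j * W \<omega> $$ (i, j)) = (\<Sum>p\<in>?I. a p * X p \<omega>)"
    if "\<omega> \<in> space M" for \<omega>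
  proof -
    have "W \<omega> \<in> carrier_mat n n" "transpose_mat (W \<omega>) = W \<omega>"
      using W that by (auto simp: gaussian_symmetric_matrix_def)
    then have "W \<omega> $$ (j, i) = W \<omega> $$ (i, j)" if "i < n" "j < n" for i j
      using that by (metis carrier_matD index_transpose_mat(1))
    then show ?thesis
      unfolding sum_pairs_fold by (intro sum.cong) (auto simp: a_def X_def distrib_right)
  qed
  then have "{\<omega> \<in> space M. t \<le> (\<Sum>i<n. \<Sum>j<n. A i j * W \<omega> $$ (i, j))} =
      {\<omega> \<in> space M. t \<le> (\<Sum>p\<in>?I. a p * X p \<omega>)}"
    by auto
  also have "prob \<dots> \<le> exp (- t\<^sup>2 / (2 * v))"
  proof (rule std_normal_combination_tail[OF fin _ _ le_v \<open>v > 0\<close> \<open>t \<ge> 0\<close>])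
    show "indep_vars (\<lambda>_. borel) X ?I"
      using W unfolding gaussian_symmetric_matrix_def X_def by blast
    show "distributed M lborel (X p) std_normal_density" if "p \<in> ?I" for p
      using W that by (auto simp: gaussian_symmetric_matrix_def X_def)
  qed
  finally show ?thesis .
qed

lemma gaussian_entry_measurable:
  assumes "gaussian_symmetric_matrix M n W" "i < n" "j < n"
  shows "(\<lambda>\<omega>. W \<omega> $$ (i, j)) \<in> borel_measurable M"
  using assms distributed_measurable[of M lborel "\<lambda>\<omega>. W \<omega> $$ (i, j)" std_normal_density]
  by (auto simp: gaussian_symmetric_matrix_def)

text \<open>\<open>A\<close> lives on a single row, so \<open>\<kappa> = 1\<close> applies and the
  variance is exactly \<open>n\<close>. This sharp value is what the threshold
  \<open>2 + \<epsilon>\<close> rests on. The sign in \<open>A\<close> turns the lower tail into an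
  upper one.\<close>

lemma gaussian_row_tail:
  assumes M: "prob_space M" and W: "gaussian_symmetric_matrix M n W"
    and s: "\<And>i. i < n \<Longrightarrow> s i \<in> {-1, 1::real}" and "i < n" "t \<ge> 0"
  shows "measure M {\<omega> \<in> space M. (\<Sum>j<n. s i * s j * W \<omega> $$ (i, j)) \<le> - t} \<le> exp (- t\<^sup>2 / (2 * real n))"
proof -
  define A where "A a b = (if a = i then - (s i * s b) else 0)" for a b
  have [simp]: "(s a)\<^sup>2 = 1" if "a < n" for a using s[OF that] by auto
  have "(\<Sum>a<n. \<Sum>b<n. (A a b)\<^sup>2) = (\<Sum>a<n. if a = i then real n else 0)"
    by (intro sum.cong) (auto simp: A_def power_mult_distrib \<open>i < n\<close>)
  then have "(\<Sum>a<n. \<Sum>b<n. (A a b)\<^sup>2) = n" using \<open>i < n\<close> by simp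
  then have "measure M {\<omega> \<in> space M. t \<le> (\<Sum>a<n. \<Sum>b<n. A a b * W \<omega> $$ (a, b))} \<le> exp (- t\<^sup>2 / (2 * real n))"
    using \<open>i < n\<close> \<open>t \<ge> 0\<close>
    by (intro gaussian_form_tail[OF M W, where \<kappa>=1]) (auto simp: A_def)
  moreover have "(\<Sum>a<n. \<Sum>b<n. A a b * W \<omega> $$ (a, b)) = - (\<Sum>j<n. s i * s j * W \<omega> $$ (i, j))" for \<omega>
  proof -
    have "(\<Sum>a<n. \<Sum>b<n. A a b * W \<omega> $$ (a, b)) = (\<Sum>a<n. if a = i then - (\<Sum>j<n. s i * s j * W \<omega> $$ (i, j)) else 0)"
      by (intro sum.cong) (auto simp: A_def sum_negf)
    then show ?thesis using \<open>i < n\<close> by simp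
  qed
  ultimately show ?thesis by (simp add: le_minus_iff)
qed

text \<open>With \<open>\<kappa> = 2\<close> the variance bound is
  \<open>2 (16 n)^2 = 512 n^2\<close>, and \<open>192^2 n^3 / (2 * 512 n^2) = 36 n\<close>. This
  outweighs the \<open>2 ^ (18 n)\<close> points of the net.\<close>

lemma gaussian_qf_tail:
  assumes M: "prob_space M" and W: "gaussian_symmetric_matrix M n W" and "n \<ge> 1"
    and k: "(\<Sum>i<n. (x i)\<^sup>2) \<le> 16 * real n"
  shows "measure M {\<omega> \<in> space M. 192 * real n * sqrt n \<le> \<bar>qf n (\<lambda>i j. W \<omega> $$ (i, j)) x\<bar>} \<le> 2 * exp (- 36 * real n)"
proof -
  interpret prob_space M by (rule M)
  have [measurable]: "(\<lambda>\<omega>. W \<omega> $$ (i, j)) \<in> borel_measurable M" if "i < n" "j < n" for i j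
    using gaussian_entry_measurable[OF W that] .
  let ?q = "\<lambda>\<omega>. qf n (\<lambda>i j. W \<omega> $$ (i, j)) x" and ?t = "192 * real n * sqrt n"
  have q_meas: "?q \<in> borel_measurable M" unfolding qf_def by measurable
  have tail: "prob {\<omega> \<in> space M. ?t \<le> c * ?q \<omega>} \<le> exp (- 36 * real n)" if "c\<^sup>2 = 1" for c :: real
  proof -
    have "(\<Sum>i<n. \<Sum>j<n. (c * (x i * x j))\<^sup>2) = (\<Sum>i<n. (x i)\<^sup>2) * (\<Sum>j<n. (x j)\<^sup>2)"
      by (simp add: power_mult_distrib that sum_product)
    also have "\<dots> \<le> 16 * real n * (16 * real n)"
      using k by (intro mult_mono) (auto intro: sum_nonneg)
    finally have "2 * (\<Sum>i<n. \<Sum>j<n. (c * (x i * x j))\<^sup>2) \<le> 512 * (real n)\<^sup>2"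
      by (simp add: power2_eq_square)
    then have "prob {\<omega> \<in> space M. ?t \<le> (\<Sum>i<n. \<Sum>j<n. c * (x i * x j) * W \<omega> $$ (i, j))}
        \<le> exp (- ?t\<^sup>2 / (2 * (512 * (real n)\<^sup>2)))"
      using \<open>n \<ge> 1\<close>
      by (intro gaussian_form_tail[OF M W, where \<kappa>=2]) (auto simp: power2_eq_square algebra_simps)
    also have "?t\<^sup>2 = 36864 * real n * (real n)\<^sup>2"
      by (simp add: power_mult_distrib)
    also have "- (36864 * real n * (real n)\<^sup>2) / (2 * (512 * (real n)\<^sup>2)) = - 36 * real n"
      using \<open>n \<ge> 1\<close> by simp
    finally show ?thesis by (simp add: qf_def sum_distrib_left mult_ac)
  qed
  let ?A = "\<lambda>c. {\<omega> \<in> space M. ?t \<le> c * ?q \<omega>}"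
  have "{\<omega> \<in> space M. ?t \<le> \<bar>?q \<omega>\<bar>} = ?A 1 \<union> ?A (-1)"
    by auto
  then have "prob {\<omega> \<in> space M. ?t \<le> \<bar>?q \<omega>\<bar>} = prob (?A 1 \<union> ?A (-1))" by (rule arg_cong)
  moreover have "prob (?A 1 \<union> ?A (-1)) \<le> prob (?A 1) + prob (?A (-1))"
    by (intro measure_Un_le borel_measurable_le borel_measurable_times borel_measurable_const q_meas)
  moreover have "prob (?A 1) \<le> exp (- 36 * real n)" "prob (?A (-1)) \<le> exp (- 36 * real n)"
    by (rule tail, simp)+
  ultimately show ?thesis by linarith
qed

text \<open>Union bound over the lattice ball, with \<open>2 \<le> exp 1\<close>. The bound for all
  \<open>x\<close> is an uncountable conjunction, so the statement supplies a measurable exceptional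
  set \<open>B\<close> outside of which it holds.\<close>

lemma gaussian_qf_bound:
  assumes M: "prob_space M" and W: "gaussian_symmetric_matrix M n W" and "n \<ge> 1"
  shows "\<exists>B\<in>sets M. measure M B \<le> 2 * exp (- 18 * real n) \<and>
    (\<forall>\<omega>\<in>space M - B. \<forall>x. \<bar>qf n (\<lambda>i j. W \<omega> $$ (i, j)) x\<bar> \<le> 24 * sqrt n * (\<Sum>i<n. (x i)\<^sup>2))"
proof -
  interpret prob_space M by (rule M)
  have [measurable]: "(\<lambda>\<omega>. W \<omega> $$ (i, j)) \<in> borel_measurable M" if "i < n" "j < n" for i j
    using gaussian_entry_measurable[OF W that] .
  define A where "A k = {\<omega> \<in> space M. 192 * real n * sqrt n \<le> \<bar>qf n (\<lambda>i j. W \<omega> $$ (i, j)) (\<lambda>i. of_int (k i))\<bar>}"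
    for k :: "nat \<Rightarrow> int"
  have "(\<lambda>\<omega>. qf n (\<lambda>i j. W \<omega> $$ (i, j)) x) \<in> borel_measurable M" for x
    unfolding qf_def by measurable
  then have A_sets: "A k \<in> sets M" for k
    unfolding A_def by (intro borel_measurable_le borel_measurable_abs borel_measurable_const)
  have "measure M (\<Union>k\<in>lattice_ball n. A k) \<le> (\<Sum>k\<in>lattice_ball n. measure M (A k))"
    using A_sets by (intro finite_measure_subadditive_finite finite_lattice_ball) auto
  also have "\<dots> \<le> (\<Sum>k\<in>lattice_ball n. 2 * exp (- 36 * real n))"
  proof (rule sum_mono)
    fix k assume "k \<in> lattice_ball n"
    then have "(\<Sum>i<n. (k i)\<^sup>2) \<le> 16 * int n" by (simp add: lattice_ball_def)
    then have "real_of_int (\<Sum>i<n. (k i)\<^sup>2) \<le> real_of_int (16 * int n)" by (simp only: of_int_le_iff)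
    then show "measure M (A k) \<le> 2 * exp (- 36 * real n)"
      unfolding A_def by (intro gaussian_qf_tail[OF M W \<open>n \<ge> 1\<close>]) simp
  qed
  also have "\<dots> \<le> 2 ^ (18 * n) * (2 * exp (- 36 * real n))"
    using mult_right_mono[OF card_lattice_ball[of n], of "2 * exp (- 36 * real n)"] by simp
  also have "\<dots> \<le> exp (18 * real n) * (2 * exp (- 36 * real n))"
  proof -
    have "(2::real) \<le> exp 1" using exp_ge_add_one_self[of 1] by simp
    then have "2 ^ (18 * n) \<le> exp (1::real) ^ (18 * n)" by (intro power_mono) auto
    then show ?thesis by (intro mult_right_mono) (auto simp: exp_of_nat_mult[symmetric])
  qed
  also have "\<dots> = 2 * exp (- 18 * real n)"
    by (simp add: exp_add[symmetric])
  finally have "measure M (\<Union>k\<in>lattice_ball n. A k) \<le> 2 * exp (- 18 * real n)" .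
  moreover have "\<bar>qf n (\<lambda>i j. W \<omega> $$ (i, j)) x\<bar> \<le> 24 * sqrt n * (\<Sum>i<n. (x i)\<^sup>2)"
    if \<omega>: "\<omega> \<in> space M - (\<Union>k\<in>lattice_ball n. A k)" for \<omega> x
  proof (rule qf_bound_of_lattice_bound[OF \<open>n \<ge> 1\<close>])
    fix k :: "nat \<Rightarrow> int" assume k: "(\<Sum>i<n. (k i)\<^sup>2) \<le> 16 * int n"
    have "k i \<in> {- int (16 * n)..int (16 * n)}" if "i < n" for i
    proof -
      have "\<bar>k i\<bar> \<le> (k i)\<^sup>2" by (rule abs_le_square_int)
      also have "\<dots> \<le> (\<Sum>i<n. (k i)\<^sup>2)" using that by (intro member_le_sum) auto
      finally show ?thesis using k by auto
    qed
    \<comment> \<open>Members of the lattice ball are extensional; restricting \<open>k\<close> does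
      not change the form.\<close>
    then have "restrict k {..<n} \<in> lattice_ball n" using k by (auto simp: lattice_ball_def)
    with \<omega> have "\<omega> \<notin> A (restrict k {..<n})" by blast
    then show "\<bar>qf n (\<lambda>i j. W \<omega> $$ (i, j)) (\<lambda>i. of_int (k i))\<bar> \<le> 192 * real n * sqrt n"
      using \<omega> by (simp add: A_def qf_def)
  qed
  ultimately show ?thesis using A_sets finite_lattice_ball by (intro bexI[of _ "\<Union>k\<in>lattice_ball n. A k"]) auto
qed

section \<open>Gauge transformation and conditioning\<close>

text \<open>Multiplying the rows of \<open>Y\<close> by signs is an isometry of the product of
  spheres, and conjugating \<open>C\<close> by the same signs preserves the objective. The
  multipliers do not change, and the projection commutes with the signs once \<open>Z\<close> is
  multiplied by them.\<close>

lemma soc_gauge: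
  assumes soc: "soc n r C Y" and s: "\<And>i. i < n \<Longrightarrow> s i \<in> {-1, 1}"
  shows "soc n r (\<lambda>i j. s i * s j * C i j) (\<lambda>i l. s i * Y i l)"
proof -
  let ?C = "\<lambda>i j. s i * s j * C i j" and ?Y = "\<lambda>i l. s i * Y i l"
  have ss: "s i * s i = 1" if "i < n" for i using s[OF that] by auto
  have ss': "s i * (s i * x) = x" if "i < n" for i x using ss[OF that] by (simp flip: mult.assoc)
  have m: "multiplier n r ?C ?Y i = multiplier n r C Y i" if "i < n" for i
    unfolding multiplier_def
  proof (rule sum.cong)
    fix j assume "j \<in> {..<n}"
    then have "j < n" by simp
    have "(\<Sum>l<r. s i * Y i l * (s j * Y j l)) = s i * s j * (\<Sum>l<r. Y i l * Y j l)"
      by (simp add: sum_distrib_left mult_ac)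
    then have "?C i j * (\<Sum>l<r. ?Y i l * ?Y j l) = (s i * s i) * (s j * s j) * (C i j * (\<Sum>l<r. Y i l * Y j l))"
      by (simp add: mult_ac)
    then show "?C i j * (\<Sum>l<r. ?Y i l * ?Y j l) = C i j * (\<Sum>l<r. Y i l * Y j l)"
      using ss \<open>i < n\<close> \<open>j < n\<close> by simp
  qed simp
  have rp: "row_proj r ?Y Z i l = s i * row_proj r Y (\<lambda>i l. s i * Z i l) i l" if "i < n" for Z i l
  proof -
    have "(\<Sum>k<r. Z i k * (s i * Y i k)) = s i * (\<Sum>k<r. Z i k * Y i k)"
      "(\<Sum>k<r. s i * Z i k * Y i k) = s i * (\<Sum>k<r. Z i k * Y i k)"
      by (simp_all add: sum_distrib_left mult_ac)
    then show ?thesis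
      by (simp add: row_proj_def right_diff_distrib ss'[OF that] mult.assoc)
  qed
  show ?thesis
    unfolding soc_def
  proof (intro conjI allI impI)
    fix i assume "i < n"
    then show "(\<Sum>l<r. (s i * Y i l)\<^sup>2) = 1"
      using soc ss[of i] by (simp add: soc_def power_mult_distrib power2_eq_square[of "s _"])
  next
    fix i l assume "i < n" "l < r"
    have "(\<Sum>j<n. s i * s j * C i j * (s j * Y j l)) = (\<Sum>j<n. s i * (C i j * Y j l))"
    proof (rule sum.cong)
      fix j assume "j \<in> {..<n}"
      have "s i * s j * C i j * (s j * Y j l) = (s j * s j) * (s i * (C i j * Y j l))" by (simp add: mult_ac)
      then show "s i * s j * C i j * (s j * Y j l) = s i * (C i j * Y j l)"
        using ss[of j] \<open>j \<in> {..<n}\<close> by simp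
    qed simp
    then show "(\<Sum>j<n. s i * s j * C i j * (s j * Y j l)) = multiplier n r ?C ?Y i * (s i * Y i l)"
      using soc \<open>i < n\<close> \<open>l < r\<close> m by (simp add: soc_def flip: sum_distrib_left)
  next
    fix Z
    let ?V = "row_proj r Y (\<lambda>i l. s i * Z i l)"
    have "(\<Sum>i<n. \<Sum>j<n. ?C i j * (\<Sum>l<r. row_proj r ?Y Z i l * row_proj r ?Y Z j l))
        = (\<Sum>i<n. \<Sum>j<n. C i j * (\<Sum>l<r. ?V i l * ?V j l))"
    proof (intro sum.cong refl)
      fix i j assume "i \<in> {..<n}" "j \<in> {..<n}"
      then have ij: "i < n" "j < n" by auto
      then have "(\<Sum>l<r. row_proj r ?Y Z i l * row_proj r ?Y Z j l) = s i * s j * (\<Sum>l<r. ?V i l * ?V j l)"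
        by (simp add: rp sum_distrib_left mult_ac)
      then have "?C i j * (\<Sum>l<r. row_proj r ?Y Z i l * row_proj r ?Y Z j l)
          = (s i * s i) * (s j * s j) * (C i j * (\<Sum>l<r. ?V i l * ?V j l))"
        by (simp add: mult_ac)
      then show "?C i j * (\<Sum>l<r. row_proj r ?Y Z i l * row_proj r ?Y Z j l)
          = C i j * (\<Sum>l<r. ?V i l * ?V j l)"
        using ss ij by simp
    qed
    also have "\<dots> \<le> (\<Sum>i<n. multiplier n r C Y i * (\<Sum>l<r. (?V i l)\<^sup>2))"
      using soc by (simp add: soc_def)
    also have "\<dots> = (\<Sum>i<n. multiplier n r ?C ?Y i * (\<Sum>l<r. (row_proj r ?Y Z i l)\<^sup>2))"
      by (intro sum.cong refl) (simp add: m rp power_mult_distrib power2_eq_square[of "s _"] ss)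
    finally show "(\<Sum>i<n. \<Sum>j<n. ?C i j * (\<Sum>l<r. row_proj r ?Y Z i l * row_proj r ?Y Z j l))
        \<le> (\<Sum>i<n. multiplier n r ?C ?Y i * (\<Sum>l<r. (row_proj r ?Y Z i l)\<^sup>2))" .
  qed
qed

section \<open>Conditioning of the Laplacian\<close>

lemma bilinear_bound_of_qf_bound:
  assumes sym: "\<And>i j. i < n \<Longrightarrow> j < n \<Longrightarrow> w i j = w j i"
    and bound: "\<And>x. \<bar>qf n w x\<bar> \<le> K * (\<Sum>i<n. (x i)\<^sup>2)"
  shows "\<bar>\<Sum>i<n. \<Sum>j<n. u i * v j * w i j\<bar> \<le> K / 2 * ((\<Sum>i<n. (u i)\<^sup>2) + (\<Sum>i<n. (v i)\<^sup>2))"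
proof -
  let ?B = "\<lambda>u v. \<Sum>i<n. \<Sum>j<n. u i * v j * w i j"
  have "?B v u = (\<Sum>j<n. \<Sum>i<n. v i * u j * w i j)" by (rule sum.swap)
  also have "\<dots> = ?B u v" by (intro sum.cong refl) (auto simp: sym mult_ac)
  finally have B_sym: "?B v u = ?B u v" .
  have "(u i + v i) * (u j + v j) * w i j - (u i - v i) * (u j - v j) * w i j
      = 2 * (u i * v j * w i j) + 2 * (v i * u j * w i j)" for i j
    by (simp add: algebra_simps)
  then have "qf n w (\<lambda>i. u i + v i) - qf n w (\<lambda>i. u i - v i) = 2 * ?B u v + 2 * ?B v u"
    unfolding qf_def sum_subtractf[symmetric] by (simp add: sum.distrib sum_distrib_left)
  then have "4 * ?B u v = qf n w (\<lambda>i. u i + v i) - qf n w (\<lambda>i. u i - v i)"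
    using B_sym by simp
  moreover have "(\<Sum>i<n. (u i + v i)\<^sup>2) + (\<Sum>i<n. (u i - v i)\<^sup>2)
      = 2 * (\<Sum>i<n. (u i)\<^sup>2) + 2 * (\<Sum>i<n. (v i)\<^sup>2)"
    unfolding sum_distrib_left sum.distrib[symmetric]
    by (intro sum.cong) (auto simp: power2_eq_square algebra_simps)
  moreover have "K * p + K * q = 4 * (K / 2 * (a + b))" if "p + q = 2 * a + 2 * b" for p q a b :: real
    using arg_cong[OF that, of "\<lambda>x. K * x"] by (simp add: distrib_left)
  ultimately have "4 * ?B u v = qf n w (\<lambda>i. u i + v i) - qf n w (\<lambda>i. u i - v i)"
    and "K * (\<Sum>i<n. (u i + v i)\<^sup>2) + K * (\<Sum>i<n. (u i - v i)\<^sup>2)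
      = 4 * (K / 2 * ((\<Sum>i<n. (u i)\<^sup>2) + (\<Sum>i<n. (v i)\<^sup>2)))"
    by blast+
  then show ?thesis
    using bound[of "\<lambda>i. u i + v i"] bound[of "\<lambda>i. u i - v i"] by linarith
qed

text \<open>The bilinear bound is applied to \<open>x\<close> and a constant vector
  \<open>t\<close>, where \<open>n t^2 = |x|^2\<close> balances its two terms.\<close>

lemma sum_row_bound_of_qf_bound:
  assumes "\<And>i j. i < n \<Longrightarrow> j < n \<Longrightarrow> w i j = w j i"
    and "\<And>x. \<bar>qf n w x\<bar> \<le> K * (\<Sum>i<n. (x i)\<^sup>2)"
  shows "(\<Sum>i<n. \<Sum>j<n. x i * w i j)\<^sup>2 \<le> K\<^sup>2 * n * (\<Sum>i<n. (x i)\<^sup>2)"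
proof (cases "(\<Sum>i<n. (x i)\<^sup>2) = 0")
  case True
  then have "x i = 0" if "i < n" for i using that by (simp add: sum_nonneg_eq_0_iff)
  with True show ?thesis by simp
next
  case False
  let ?N = "\<Sum>i<n. (x i)\<^sup>2" and ?S = "\<Sum>i<n. \<Sum>j<n. x i * w i j"
  have pos: "?N > 0" using False by (simp add: order.not_eq_order_implies_strict sum_nonneg)
  then have n: "n > 0" by (cases n) auto
  define t where "t = sqrt (?N / n)"
  have t: "t > 0" "t\<^sup>2 = ?N / n" using pos n by (auto simp: t_def)
  have "(\<Sum>i<n. \<Sum>j<n. x i * t * w i j) = t * ?S"
    by (simp add: sum_distrib_left mult_ac)
  then have "\<bar>t * ?S\<bar> \<le> K / 2 * (?N + (\<Sum>i<n. t\<^sup>2))"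
    using bilinear_bound_of_qf_bound[OF assms, of x "\<lambda>_. t"] by simp
  also have "\<dots> = K * ?N" using n t by simp
  finally have "(t * ?S)\<^sup>2 \<le> (K * ?N)\<^sup>2" by (rule abs_le_square_iff[THEN iffD1, OF order_trans]) simp
  then have "?N / n * ?S\<^sup>2 \<le> ?N / n * (K\<^sup>2 * n * ?N)"
    using n by (simp add: power_mult_distrib t power2_eq_square[of ?N] mult_ac)
  moreover have "?N / n > 0" using pos n by simp
  ultimately show ?thesis by (rule mult_left_le_imp_le)
qed

text \<open>The energy is the weighted sum of squares minus the rank-one term
  \<open>(sum x)^2\<close> and the noise term \<open>\<sigma> * qf n w x\<close>. Both are at most a
  multiple of the plain norm, which \<open>d \<ge> c n\<close> converts to the weighted one.\<close>

lemma lap_close_to_diagonal: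
  fixes n :: nat and w :: "nat \<Rightarrow> nat \<Rightarrow> real" and \<sigma> c K :: real
  defines "d \<equiv> \<lambda>i. \<Sum>j<n. 1 + \<sigma> * w i j"
  assumes sym: "\<And>i j. i < n \<Longrightarrow> j < n \<Longrightarrow> w i j = w j i"
    and bound: "\<And>x. \<bar>qf n w x\<bar> \<le> K * (\<Sum>i<n. (x i)\<^sup>2)"
    and d: "\<And>i. i < n \<Longrightarrow> c * n \<le> d i" and "c > 0" "\<sigma> \<ge> 0" "K \<ge> 0" "n > 0"
    and centered: "(\<Sum>i<n. d i * x i) = 0"
  shows "\<bar>lap n (\<lambda>i j. 1 + \<sigma> * w i j) x x - (\<Sum>i<n. d i * (x i)\<^sup>2)\<bar>
    \<le> ((\<sigma> * K)\<^sup>2 / n + \<sigma> * K) / (c * n) * (\<Sum>i<n. d i * (x i)\<^sup>2)"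
proof -
  let ?N = "\<Sum>i<n. (x i)\<^sup>2"
  have "lap n (\<lambda>i j. 1 + \<sigma> * w i j) x x =
      (\<Sum>i<n. d i * (x i)\<^sup>2 - (\<Sum>j<n. x i * x j) - \<sigma> * (\<Sum>j<n. x i * x j * w i j))"
    unfolding lap_def d_def
  proof (rule sum.cong)
    fix i
    have "x i * (\<Sum>j<n. (1 + \<sigma> * w i j) * (x i - x j)) =
      (\<Sum>j<n. (1 + \<sigma> * w i j) * (x i)\<^sup>2 - x i * x j - \<sigma> * (x i * x j * w i j))"
      unfolding sum_distrib_left by (intro sum.cong) (auto simp: power2_eq_square algebra_simps)
    then show "x i * (\<Sum>j<n. (1 + \<sigma> * w i j) * (x i - x j)) =
      (\<Sum>j<n. 1 + \<sigma> * w i j) * (x i)\<^sup>2 - (\<Sum>j<n. x i * x j) - \<sigma> * (\<Sum>j<n. x i * x j * w i j)"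
      by (simp only: sum_subtractf sum_distrib_left sum_distrib_right)
  qed simp
  also have "\<dots> = (\<Sum>i<n. d i * (x i)\<^sup>2) - (\<Sum>i<n. x i)\<^sup>2 - \<sigma> * qf n w x"
    by (simp add: sum_subtractf qf_def power2_eq_square sum_product flip: sum_distrib_left)
  finally have eq: "lap n (\<lambda>i j. 1 + \<sigma> * w i j) x x - (\<Sum>i<n. d i * (x i)\<^sup>2)
    = - ((\<Sum>i<n. x i)\<^sup>2 + \<sigma> * qf n w x)" by simp
  \<comment> \<open>Centering under \<open>d\<close> expresses \<open>n\<close> times the plain sum
    of \<open>x\<close> through the noise alone, which makes the rank-one term small.\<close>
  have "(\<Sum>i<n. d i * x i) = (\<Sum>i<n. real n * x i + \<sigma> * (\<Sum>j<n. x i * w i j))"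
    by (intro sum.cong) (auto simp: d_def sum.distrib sum_distrib_left sum_distrib_right algebra_simps)
  then have "real n * (\<Sum>i<n. x i) = - (\<sigma> * (\<Sum>i<n. \<Sum>j<n. x i * w i j))"
    using centered by (simp add: sum.distrib flip: sum_distrib_left)
  then have "(real n * (\<Sum>i<n. x i))\<^sup>2 = (\<sigma> * (\<Sum>i<n. \<Sum>j<n. x i * w i j))\<^sup>2"
    by (simp only: power2_minus)
  then have "(real n)\<^sup>2 * (\<Sum>i<n. x i)\<^sup>2 = \<sigma>\<^sup>2 * (\<Sum>i<n. \<Sum>j<n. x i * w i j)\<^sup>2"
    by (simp only: power_mult_distrib)
  also have "\<dots> \<le> \<sigma>\<^sup>2 * (K\<^sup>2 * n * ?N)"
    by (intro mult_left_mono sum_row_bound_of_qf_bound[OF sym bound]) auto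
  also have "\<dots> = (real n)\<^sup>2 * ((\<sigma> * K)\<^sup>2 / n * ?N)"
    using \<open>n > 0\<close> by (simp add: power2_eq_square field_simps)
  finally have mean: "(\<Sum>i<n. x i)\<^sup>2 \<le> (\<sigma> * K)\<^sup>2 / n * ?N"
    by (rule mult_left_le_imp_le) (use \<open>n > 0\<close> in simp)
  have "\<bar>\<sigma> * qf n w x\<bar> \<le> \<sigma> * K * ?N"
    using mult_left_mono[OF bound[of x] \<open>\<sigma> \<ge> 0\<close>] \<open>\<sigma> \<ge> 0\<close> by (simp add: abs_mult mult.assoc)
  then have "\<bar>(\<Sum>i<n. x i)\<^sup>2 + \<sigma> * qf n w x\<bar> \<le> ((\<sigma> * K)\<^sup>2 / n + \<sigma> * K) * ?N"
    unfolding distrib_right using mean zero_le_power2[of "\<Sum>i<n. x i"] by linarith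
  moreover have "?N \<le> (\<Sum>i<n. d i * (x i)\<^sup>2) / (c * n)"
  proof -
    have "(\<Sum>i<n. c * n * (x i)\<^sup>2) \<le> (\<Sum>i<n. d i * (x i)\<^sup>2)"
      by (intro sum_mono mult_right_mono) (auto intro: d)
    then show ?thesis using \<open>c > 0\<close> \<open>n > 0\<close>
      by (simp add: pos_le_divide_eq mult.commute flip: sum_distrib_left)
  qed
  then have "((\<sigma> * K)\<^sup>2 / n + \<sigma> * K) * ?N
      \<le> ((\<sigma> * K)\<^sup>2 / n + \<sigma> * K) * ((\<Sum>i<n. d i * (x i)\<^sup>2) / (c * n))"
    using \<open>\<sigma> \<ge> 0\<close> \<open>K \<ge> 0\<close> by (intro mult_left_mono) auto
  ultimately show ?thesis
    unfolding eq abs_minus_cancel times_divide_eq_left times_divide_eq_right by linarith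
qed

text \<open>A relative error of 1/21 gives the condition number
  \<open>(22/21) / (20/21) = 11/10\<close> that \<open>rows_aligned\<close> admits.\<close>

lemma soc_aligned:
  fixes n :: nat and w :: "nat \<Rightarrow> nat \<Rightarrow> real" and \<sigma> c K :: real
  assumes soc: "soc n r (\<lambda>i j. 1 + \<sigma> * w i j) Y" and "r \<ge> 2"
    and w_sym: "\<And>i j. i < n \<Longrightarrow> j < n \<Longrightarrow> w i j = w j i"
    and bound: "\<And>x. \<bar>qf n w x\<bar> \<le> K * (\<Sum>i<n. (x i)\<^sup>2)"
    and d: "\<And>i. i < n \<Longrightarrow> c * n \<le> (\<Sum>j<n. 1 + \<sigma> * w i j)" and "c > 0" "\<sigma> \<ge> 0" "K \<ge> 0"
    and small: "((\<sigma> * K)\<^sup>2 / n + \<sigma> * K) / (c * n) \<le> 1 / 21" and ij: "i < n" "j < n"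
  shows "(\<Sum>l<r. Y i l * Y j l) = 1"
proof -
  have "n > 0" using ij by simp
  define d where "d i = (\<Sum>j<n. 1 + \<sigma> * w i j)" for i
  define T where "T = (\<Sum>i<n. d i)"
  have d_pos: "d i > 0" if "i < n" for i
    using assms(5)[OF that] mult_pos_pos[OF \<open>c > 0\<close>, of "real n"] \<open>n > 0\<close> by (simp add: d_def)
  have T_pos: "T > 0" unfolding T_def using \<open>n > 0\<close> by (intro sum_pos d_pos) auto
  interpret critical_point n r "\<lambda>i j. 1 + \<sigma> * w i j" Y
    using soc w_sym by unfold_locales auto
  define p where "p i = d i / T" for i
  let ?ex = "\<lambda>x. \<Sum>i<n. p i * x i"
  have p_sum: "(\<Sum>i<n. p i) = 1"
    using T_pos by (simp add: p_def T_def flip: sum_divide_distrib)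
  have key: "\<bar>L x x - T * (?ex (\<lambda>i. (x i)\<^sup>2) - (?ex x)\<^sup>2)\<bar> \<le> 1/21 * (T * (?ex (\<lambda>i. (x i)\<^sup>2) - (?ex x)\<^sup>2))"
    for x
  proof -
    \<comment> \<open>Subtracting the weighted mean leaves the energy unchanged and centers the
      vector under \<open>d\<close>.\<close>
    define y where "y i = x i - ?ex x" for i
    have dp: "d i = T * p i" for i using T_pos by (simp add: p_def)
    have Ly: "L y y = L x x"
      unfolding y_def[abs_def] lap_diff_right lap_const_right
      by (subst lap_sym[OF sym]) (simp_all add: lap_diff_right lap_const_right sym)
    have "(\<Sum>i<n. d i * y i) = 0"
      by (simp add: dp y_def right_diff_distrib sum_subtractf mult.assoc p_sum
          flip: sum_distrib_left sum_distrib_right)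
    have dy: "(\<Sum>i<n. d i * (y i)\<^sup>2) = T * (?ex (\<lambda>i. (x i)\<^sup>2) - (?ex x)\<^sup>2)"
    proof -
      have "d i * (y i)\<^sup>2 = T * (p i * (x i)\<^sup>2 - 2 * ?ex x * (p i * x i) + (?ex x)\<^sup>2 * p i)" for i
        by (simp add: dp y_def power2_eq_square algebra_simps)
      then have "(\<Sum>i<n. d i * (y i)\<^sup>2) = T * (?ex (\<lambda>i. (x i)\<^sup>2) - 2 * ?ex x * ?ex x + (?ex x)\<^sup>2 * 1)"
        by (simp only: sum.distrib sum_subtractf sum_distrib_left[symmetric] p_sum)
      then show ?thesis by (simp add: power2_eq_square)
    qed
    have nonneg: "0 \<le> (\<Sum>i<n. d i * (y i)\<^sup>2)"
      by (intro sum_nonneg mult_nonneg_nonneg) (auto simp: less_imp_le[OF d_pos])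
    have "\<bar>L y y - (\<Sum>i<n. d i * (y i)\<^sup>2)\<bar>
        \<le> ((\<sigma> * K)\<^sup>2 / n + \<sigma> * K) / (c * n) * (\<Sum>i<n. d i * (y i)\<^sup>2)"
      unfolding d_def
      using \<open>(\<Sum>i<n. d i * y i) = 0\<close>[unfolded d_def]
      by (intro lap_close_to_diagonal w_sym bound assms(5) \<open>c > 0\<close> \<open>\<sigma> \<ge> 0\<close> \<open>K \<ge> 0\<close> \<open>n > 0\<close>)
    also note mult_right_mono[OF small nonneg]
    finally show ?thesis unfolding Ly dy .
  qed
  show ?thesis
  proof (rule rows_aligned[where p=p and \<alpha>="20/21 * T" and \<beta>="22/21 * T", OF \<open>r \<ge> 2\<close>])
    show "20/21 * T * (?ex (\<lambda>i. (x i)\<^sup>2) - (?ex x)\<^sup>2) \<le> L x x" for x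
      using key[of x] unfolding mult.assoc by linarith
    show "L x x \<le> 22/21 * T * (?ex (\<lambda>i. (x i)\<^sup>2) - (?ex x)\<^sup>2)" for x
      using key[of x] unfolding mult.assoc by linarith
  qed (use T_pos d_pos ij p_sum in \<open>auto simp: p_def\<close>)
qed

section \<open>The benign landscape\<close>

text \<open>A bound for each fixed \<open>n\<close>: the exponential term pays for the operator
  norm, the power of \<open>n\<close> for the row sums. The hypothesis \<open>small\<close> collects
  what holds only for large \<open>n\<close>.\<close>

lemma benign_probability:
  fixes z :: "real Matrix.vec" and \<sigma> \<epsilon> :: real
  assumes M: "prob_space M" and W: "gaussian_symmetric_matrix M n W"
    and z: "z \<in> carrier_vec n" "\<And>i. i < n \<Longrightarrow> vec_index z i \<in> {-1, 1}"
    and "\<sigma> \<ge> 0" "\<epsilon> > 0" "n \<ge> 2"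
    and \<sigma>_le: "\<sigma> \<le> sqrt (real n / ((2 + \<epsilon>) * ln (real n)))"
    and small: "(576 / ln (real n) + 24 / sqrt (ln (real n))) / (1 - sqrt ((2 + \<epsilon> / 2) / (2 + \<epsilon>))) \<le> 1 / 21"
  shows "1 - (2 * exp (- 18 * real n) + real n powr (- \<epsilon> / 4)) \<le> \<P>(\<omega> in M.
    \<forall>r \<ge> 2. \<forall>Y. second_order_critical n r
        (\<lambda>X. mat_inner (outer z + \<sigma> \<cdot>\<^sub>m W \<omega>) (X * transpose_mat X)) Y
      \<longrightarrow> Y * transpose_mat Y = outer z)"
proof -
  interpret prob_space M by (rule M)
  define C where "C \<omega> = outer z + \<sigma> \<cdot>\<^sub>m W \<omega>" for \<omega>
  define E where "E = {\<omega> \<in> space M. \<forall>r \<ge> (2::nat). \<forall>Y. second_order_critical n r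
        (\<lambda>X. mat_inner (C \<omega>) (X * transpose_mat X)) Y \<longrightarrow> Y * transpose_mat Y = outer z}"
  define s where "s i = vec_index z i" for i
  \<comment> \<open>The constant \<open>2 + \<epsilon> / 2\<close> lies strictly between 2 and
    \<open>2 + \<epsilon>\<close>. Exceeding 2 lets the tail at \<open>T\<close> survive a union
    bound over \<open>n\<close> rows; staying below \<open>2 + \<epsilon>\<close> gives
    \<open>\<sigma> T \<le> q n\<close> with \<open>q < 1\<close>, so row sums keep a fraction
    \<open>c\<close> of \<open>n\<close>.\<close>
  define q where "q = sqrt ((2 + \<epsilon> / 2) / (2 + \<epsilon>))"
  define c where "c = 1 - q"
  define T where "T = sqrt ((2 + \<epsilon> / 2) * real n * ln (real n))"
  have s: "s i \<in> {-1, 1}" if "i < n" for i using z that by (simp add: s_def)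
  have ss: "s i * s i = 1" if "i < n" for i using s[OF that] by auto
  have ln_pos: "ln (real n) > 0" using \<open>n \<ge> 2\<close> by simp
  have "q < 1" using \<open>\<epsilon> > 0\<close> by (simp add: q_def)
  then have "c > 0" by (simp add: c_def)
  have T_nonneg: "T \<ge> 0" using ln_pos \<open>\<epsilon> > 0\<close> by (simp add: T_def)

  have Wc: "W \<omega> \<in> carrier_mat n n" and Wt: "transpose_mat (W \<omega>) = W \<omega>" if "\<omega> \<in> space M" for \<omega>
    using W that by (auto simp: gaussian_symmetric_matrix_def)
  have W_sym: "W \<omega> $$ (i, j) = W \<omega> $$ (j, i)" if "\<omega> \<in> space M" "i < n" "j < n" for \<omega> i j
    using Wc[OF that(1)] Wt[OF that(1)] that by (metis carrier_matD index_transpose_mat(1))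
  have Cc: "C \<omega> \<in> carrier_mat n n" if "\<omega> \<in> space M" for \<omega>
    using Wc[OF that] by (simp add: C_def)
  have C_entry: "C \<omega> $$ (i, j) = s i * s j + \<sigma> * W \<omega> $$ (i, j)" if "\<omega> \<in> space M" "i < n" "j < n" for \<omega> i j
    using Wc[OF that(1)] that z by (simp add: C_def outer_def s_def)
  have Ct: "transpose_mat (C \<omega>) = C \<omega>" if "\<omega> \<in> space M" for \<omega>
    using Cc[OF that] by (intro eq_matI) (auto simp: C_entry that W_sym[OF that, of _ _] mult.commute)

  obtain B where B: "B \<in> sets M" "measure M B \<le> 2 * exp (- 18 * real n)"
    and B_bound: "\<And>\<omega> x. \<omega> \<in> space M - B \<Longrightarrow>
      \<bar>qf n (\<lambda>i j. W \<omega> $$ (i, j)) x\<bar> \<le> 24 * sqrt n * (\<Sum>i<n. (x i)\<^sup>2)"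
    using gaussian_qf_bound[OF M W] \<open>n \<ge> 2\<close> by auto
  define R where "R i = {\<omega> \<in> space M. (\<Sum>j<n. s i * s j * W \<omega> $$ (i, j)) \<le> - T}" for i
  have R: "R i \<in> sets M" if "i < n" for i
    unfolding R_def using that
    by (intro borel_measurable_le borel_measurable_sum borel_measurable_times borel_measurable_const
        gaussian_entry_measurable[OF W]) auto
  have "measure M (\<Union>i<n. R i) \<le> (\<Sum>i<n. measure M (R i))"
    using R by (intro finite_measure_subadditive_finite) auto
  also have "\<dots> \<le> (\<Sum>i<n. real n powr (- \<epsilon> / 4 - 1))"
  proof (rule sum_mono)
    fix i assume "i \<in> {..<n}"
    then have "measure M (R i) \<le> exp (- T\<^sup>2 / (2 * real n))"
      unfolding R_def using T_nonneg s by (intro gaussian_row_tail[OF M W]) auto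
    also have "T\<^sup>2 = (2 + \<epsilon> / 2) * real n * ln (real n)"
      using ln_pos \<open>\<epsilon> > 0\<close> by (simp add: T_def)
    \<comment> \<open>Each row fails with probability at most
      \<open>n powr (- 1 - \<epsilon> / 4)\<close>; summing over the \<open>n\<close> rows costs the
      power 1.\<close>
    also have "- ((2 + \<epsilon> / 2) * real n * ln (real n)) / (2 * real n) = (- \<epsilon> / 4 - 1) * ln (real n)"
      using \<open>n \<ge> 2\<close> by (simp add: field_simps)
    also have "exp \<dots> = real n powr (- \<epsilon> / 4 - 1)"
      using \<open>n \<ge> 2\<close> by (simp add: powr_def)
    finally show "measure M (R i) \<le> real n powr (- \<epsilon> / 4 - 1)" .
  qed
  also have "\<dots> = real n powr (- \<epsilon> / 4)"
    using \<open>n \<ge> 2\<close> by (simp add: powr_diff)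
  finally have R_prob: "measure M (\<Union>i<n. R i) \<le> real n powr (- \<epsilon> / 4)" .

  have "\<sigma> * T \<le> sqrt (real n / ((2 + \<epsilon>) * ln (real n))) * T"
    using \<sigma>_le T_nonneg by (rule mult_right_mono)
  also have "\<dots> = sqrt ((real n)\<^sup>2 * ((2 + \<epsilon> / 2) / (2 + \<epsilon>)))"
    unfolding T_def real_sqrt_mult[symmetric] using ln_pos
    by (intro arg_cong[where f=sqrt]) (simp add: power2_eq_square)
  also have "\<dots> = real n * q" by (simp only: real_sqrt_mult q_def real_sqrt_abs abs_of_nat)
  finally have \<sigma>T: "\<sigma> * T \<le> real n * q" .

  have "\<sigma> \<le> sqrt (real n / ln (real n))"
  proof (rule order_trans[OF \<sigma>_le])
    have "ln (real n) \<le> (2 + \<epsilon>) * ln (real n)" using ln_pos \<open>\<epsilon> > 0\<close> by simp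
    then show "sqrt (real n / ((2 + \<epsilon>) * ln (real n))) \<le> sqrt (real n / ln (real n))"
      using ln_pos by (intro real_sqrt_le_mono divide_left_mono) auto
  qed
  then have "\<sigma> * (24 * sqrt (real n)) \<le> sqrt (real n / ln (real n)) * (24 * sqrt (real n))"
    by (rule mult_right_mono) simp
  also have "\<dots> = 24 * real n / sqrt (ln (real n))"
    by (simp add: real_sqrt_divide)
  finally have \<sigma>K: "\<sigma> * (24 * sqrt (real n)) \<le> 24 * real n / sqrt (ln (real n))" .
  then have "(\<sigma> * (24 * sqrt (real n)))\<^sup>2 \<le> (24 * real n / sqrt (ln (real n)))\<^sup>2"
    using \<open>\<sigma> \<ge> 0\<close> by (intro power_mono) auto
  also have "\<dots> = 576 * (real n)\<^sup>2 / ln (real n)"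
    using ln_pos by (simp add: power_divide power_mult_distrib)
  finally have \<sigma>K2: "(\<sigma> * (24 * sqrt (real n)))\<^sup>2 \<le> 576 * (real n)\<^sup>2 / ln (real n)" .
  have small': "((\<sigma> * (24 * sqrt (real n)))\<^sup>2 / n + \<sigma> * (24 * sqrt (real n))) / (c * n) \<le> 1 / 21"
  proof -
    have "(\<sigma> * (24 * sqrt (real n)))\<^sup>2 / n + \<sigma> * (24 * sqrt (real n))
        \<le> 576 * (real n)\<^sup>2 / ln (real n) / n + 24 * real n / sqrt (ln (real n))"
      using \<sigma>K \<sigma>K2 by (intro add_mono divide_right_mono) auto
    also have "\<dots> = (576 / ln (real n) + 24 / sqrt (ln (real n))) * n"
      using \<open>n \<ge> 2\<close> by (simp add: power2_eq_square distrib_right)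
    finally have "((\<sigma> * (24 * sqrt (real n)))\<^sup>2 / n + \<sigma> * (24 * sqrt (real n))) / (c * n)
        \<le> (576 / ln (real n) + 24 / sqrt (ln (real n))) * n / (c * n)"
      using \<open>c > 0\<close> by (intro divide_right_mono) auto
    also have "\<dots> = (576 / ln (real n) + 24 / sqrt (ln (real n))) / c"
      using \<open>n \<ge> 2\<close> by simp
    also have "\<dots> \<le> 1 / 21" using small by (simp add: c_def q_def)
    finally show ?thesis .
  qed

  have "\<omega> \<in> E" if "\<omega> \<in> space M - (B \<union> (\<Union>i<n. R i))" for \<omega>
    unfolding E_def
  proof (intro CollectI conjI allI impI)
    show \<omega>: "\<omega> \<in> space M" using that by simp
    fix r :: nat and Y assume "2 \<le> r"
      and "second_order_critical n r (\<lambda>X. mat_inner (C \<omega>) (X * transpose_mat X)) Y"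
    then have Y: "Y \<in> carrier_mat n r" and soc: "soc n r (\<lambda>i j. C \<omega> $$ (i, j)) (\<lambda>i l. Y $$ (i, l))"
      using second_order_critical_iff[OF Cc[OF \<omega>] Ct[OF \<omega>]] by auto
    define w where "w i j = s i * s j * W \<omega> $$ (i, j)" for i j
    have C_gauge: "s i * s j * C \<omega> $$ (i, j) = 1 + \<sigma> * w i j" if "i < n" "j < n" for i j
    proof -
      have "s i * s j * C \<omega> $$ (i, j) = (s i * s i) * (s j * s j) + \<sigma> * w i j"
        by (simp add: C_entry[OF \<omega> that] w_def algebra_simps)
      then show ?thesis using ss that by simp
    qed
    have "soc n r (\<lambda>i j. s i * s j * C \<omega> $$ (i, j)) (\<lambda>i l. s i * Y $$ (i, l))"
      by (rule soc_gauge[OF soc s])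
    then have gauged: "soc n r (\<lambda>i j. 1 + \<sigma> * w i j) (\<lambda>i l. s i * Y $$ (i, l))"
      using soc_cong[of n "\<lambda>i j. s i * s j * C \<omega> $$ (i, j)" "\<lambda>i j. 1 + \<sigma> * w i j" r
          "\<lambda>i l. s i * Y $$ (i, l)" "\<lambda>i l. s i * Y $$ (i, l)"] C_gauge by blast
    have w_sym: "w i j = w j i" if "i < n" "j < n" for i j
      using W_sym[OF \<omega> that] by (simp add: w_def)
    have w_bound: "\<bar>qf n w x\<bar> \<le> 24 * sqrt (real n) * (\<Sum>i<n. (x i)\<^sup>2)" for x
    proof -
      have "qf n w x = qf n (\<lambda>i j. W \<omega> $$ (i, j)) (\<lambda>i. s i * x i)"
        by (simp add: qf_def w_def mult_ac)
      moreover have "(\<Sum>i<n. (s i * x i)\<^sup>2) = (\<Sum>i<n. (x i)\<^sup>2)"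
        by (intro sum.cong) (auto simp: power_mult_distrib power2_eq_square[of "s _"] ss)
      ultimately show ?thesis using B_bound[of \<omega> "\<lambda>i. s i * x i"] that by simp
    qed
    have rows: "c * real n \<le> (\<Sum>j<n. 1 + \<sigma> * w i j)" if "i < n" for i
    proof -
      have "\<omega> \<notin> R i"
        using \<open>\<omega> \<in> space M - (B \<union> (\<Union>i<n. R i))\<close> that by blast
      then have "- T \<le> (\<Sum>j<n. w i j)"
        using \<omega> unfolding R_def w_def by simp
      then have "\<sigma> * (- T) \<le> \<sigma> * (\<Sum>j<n. w i j)" using \<open>\<sigma> \<ge> 0\<close> by (rule mult_left_mono)
      then show ?thesis using \<sigma>T
        by (simp add: sum.distrib c_def left_diff_distrib mult.commute[of q] flip: sum_distrib_left)
    qed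
    have "(\<Sum>l<r. Y $$ (i, l) * Y $$ (j, l)) = s i * s j" if "i < n" "j < n" for i j
    proof -
      have "(\<Sum>l<r. s i * Y $$ (i, l) * (s j * Y $$ (j, l))) = 1"
        using that \<open>\<sigma> \<ge> 0\<close> \<open>c > 0\<close> \<open>2 \<le> r\<close> small'
        by (intro soc_aligned[OF gauged _ w_sym w_bound rows]) auto
      moreover have "(\<Sum>l<r. s i * Y $$ (i, l) * (s j * Y $$ (j, l)))
          = s i * s j * (\<Sum>l<r. Y $$ (i, l) * Y $$ (j, l))"
        by (simp add: sum_distrib_left mult_ac)
      ultimately show ?thesis using s[OF that(1)] s[OF that(2)] by auto
    qed
    then show "Y * transpose_mat Y = outer z"
      using Y z mult_transpose_entry[OF Y Y] by (intro eq_matI) (auto simp: outer_def s_def)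
  qed
  then have subset: "space M - (B \<union> (\<Union>i<n. R i)) \<subseteq> E" by blast
  have E_sets: "E \<in> sets M"
    unfolding E_def
  proof (rule sets_benign[OF Cc Ct _ z(1)])
    fix i j assume ij: "i < n" "j < n"
    have "(\<lambda>\<omega>. s i * s j + \<sigma> * W \<omega> $$ (i, j)) \<in> borel_measurable M"
      using gaussian_entry_measurable[OF W ij] by simp
    then show "(\<lambda>\<omega>. C \<omega> $$ (i, j)) \<in> borel_measurable M"
      by (rule measurable_cong[THEN iffD2, rotated]) (simp add: C_entry ij)
  qed
  have bad: "B \<union> (\<Union>i<n. R i) \<in> sets M" using B R by auto
  have "measure M (B \<union> (\<Union>i<n. R i)) \<le> 2 * exp (- 18 * real n) + real n powr (- \<epsilon> / 4)"
    using measure_Un_le[of B M "\<Union>i<n. R i"] B R R_prob by fastforce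
  then have "1 - (2 * exp (- 18 * real n) + real n powr (- \<epsilon> / 4)) \<le> measure M (space M - (B \<union> (\<Union>i<n. R i)))"
    using prob_compl[OF bad] by simp
  also have "\<dots> \<le> measure M E"
    by (rule finite_measure_mono[OF subset E_sets])
  finally show ?thesis by (simp add: E_def C_def)
qed

theorem theorem3p1:
  fixes M :: "nat \<Rightarrow> 'a measure"
    and W :: "nat \<Rightarrow> 'a \<Rightarrow> real mat"
    and z :: "nat \<Rightarrow> real Matrix.vec"
    and \<sigma> :: "nat \<Rightarrow> real"
    and \<epsilon> :: real
    and C :: "nat \<Rightarrow> 'a \<Rightarrow> real mat"
  assumes prob: "\<And>n. prob_space (M n)"
    and W: "\<And>n. gaussian_symmetric_matrix (M n) n (W n)"
    and z_dim: "\<And>n. z n \<in> carrier_vec n"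
    and z_sign: "\<And>n i. i < n \<Longrightarrow> vec_index (z n) i \<in> {-1, 1}"
    and \<sigma>_nonneg: "\<And>n. \<sigma> n \<ge> 0"
    and \<epsilon>_pos: "\<epsilon> > 0"
    and \<sigma>_le: "\<And>n. n \<ge> 2 \<Longrightarrow> \<sigma> n \<le> sqrt (real n / ((2 + \<epsilon>) * ln (real n)))"
    and C_def: "\<And>n \<omega>. C n \<omega> = outer (z n) + \<sigma> n \<cdot>\<^sub>m W n \<omega>"
  shows "(\<lambda>n. \<P>(\<omega> in M n.
            \<forall>r \<ge> 2. \<forall>Y. second_order_critical n r (\<lambda>X. mat_inner (C n \<omega>) (X * transpose_mat X)) Y
                         \<longrightarrow> Y * transpose_mat Y = outer (z n)))
         \<longlonglongrightarrow> 1"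
proof (rule tendsto_sandwich)
  let ?c = "1 - sqrt ((2 + \<epsilon> / 2) / (2 + \<epsilon>))"
  \<comment> \<open>The denominator depends on \<open>\<epsilon>\<close> only, while both numerators
    vanish as \<open>ln n\<close> grows; so \<open>small\<close> holds eventually.\<close>
  have "(\<lambda>n. (576 / ln (real n) + 24 / sqrt (ln (real n))) / ?c) \<longlonglongrightarrow> (0 + 0) / ?c"
    using \<epsilon>_pos by (intro tendsto_divide tendsto_add tendsto_const) (real_asymp | simp)+
  then have "\<forall>\<^sub>F n in sequentially. (576 / ln (real n) + 24 / sqrt (ln (real n))) / ?c < 1 / 21"
    by (rule order_tendstoD) simp
  then show "\<forall>\<^sub>F n in sequentially. 1 - (2 * exp (- 18 * real n) + real n powr (- \<epsilon> / 4))
      \<le> \<P>(\<omega> in M n. \<forall>r \<ge> 2. \<forall>Y.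
          second_order_critical n r (\<lambda>X. mat_inner (C n \<omega>) (X * transpose_mat X)) Y
            \<longrightarrow> Y * transpose_mat Y = outer (z n))"
    using eventually_ge_at_top[of 2]
  proof eventually_elim
    case (elim n)
    then show ?case
      unfolding C_def
      by (intro benign_probability prob W z_dim z_sign \<sigma>_nonneg \<epsilon>_pos \<sigma>_le) auto
  qed
  show "\<forall>\<^sub>F n in sequentially. \<P>(\<omega> in M n. \<forall>r \<ge> 2. \<forall>Y.
          second_order_critical n r (\<lambda>X. mat_inner (C n \<omega>) (X * transpose_mat X)) Y
            \<longrightarrow> Y * transpose_mat Y = outer (z n)) \<le> 1"
    using prob_space.prob_le_1[OF prob] by (intro always_eventually allI)
  show "(\<lambda>n. 1 - (2 * exp (- 18 * real n) + real n powr (- \<epsilon> / 4))) \<longlonglongrightarrow> 1"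
    using \<epsilon>_pos by real_asymp
qed simp

end
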